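(* Consider Model 1 (described in the context) and assume $\tilde{\mathcal{A}}$ is nonempty. Let $V$ be a positive integer and define $\alpha=V^2$. With these parameters, the online algorithm described in the context satisfies the following. (a) For every vector $x\in\tilde{\mathcal{A}}$ and for all positive integers $T>0$ we have $$\frac{1}{T}\sum_{t=0}^{T-1}\mathbb{E}[f_t(X_t)]\le\frac{1}{T}\sum_{t=0}^{T-1}\mathbb{E}[f_t(x)]+\frac{C}{V}+\frac{G^2}{2V}+\frac{VD^2}{T}.$$ Hence, if $T\ge V^2$, the time average expected objective is within $O(1/V)$ of that of the optimal fixed decision $x\in\tilde{\mathcal{A}}$ (i.e. it exceeds $\frac1T\sum_{t=0}^{T-1}\mathbb{E}[f_t(x)]$ by at most $O(1/V)$ for every $x\in\tilde{\mathcal{A}}$). (b) If the Slater condition holds, then for all integers $T>0$ and all $i\in\{1,\dots,k\}$ we have $$\frac{1}{T}\sum_{t=0}^{T-1}g_{t,i}(X_t)\le\frac{\theta V}{T}+\frac{G^2}{4V}+\frac{G^2(1+\theta\sqrt{k})^2}{4V},$$ and so the expected constraints $\frac1T\sum_{t=0}^{T-1}\mathbb{E}[g_{t,i}(X_t)]$ satisfy the same inequality. Hence, if $T\ge V^2$ then the constraints are within $O(1/V)$ of being satisfied.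
   Context: Setting. Fix positive integers $n,k$. $\mathcal{X}\subseteq\mathbb{R}^n$ is a convex compact set; $\|\cdot\|$ is the Euclidean norm; $D\ge 0$ is a constant with $\|x-y\|\le D$ for all $x,y\in\mathcal{X}$. Model 1. $\Omega$ is a finite dimensional vector space and $\{\omega_t\}_{t=0}^\infty$, $\{\eta_t\}_{t=0}^\infty$ are two (possibly dependent) sequences of random vectors in $\Omega$. For $t\in\{0,1,2,\dots\}$, $i\in\{1,\dots,k\}$, $f_t(x)=\hat f(x,\eta_t)$ and $g_{t,i}(x)=\hat g_i(x,\omega_t)$, where $\hat f,\hat g_i$ are continuous and convex in $x\in\mathcal{X}$. The sequence $\{\omega_t\}_{t=0}^\infty$ is i.i.d. over $t$; the sequence $\{\eta_t\}_{t=0}^\infty$ is arbitrary and can depend on $\{\omega_t\}$. There is a constant $F\ge0$ with $|f_t(x)|\le F$, $|g_{t,i}(x)|\le F$ for all $t,i$ and $x\in\mathcal{X}$. For each of these functions a particular subgradient at each $x\in\mathcal{X}$ is fixed, denoted $f_t'(x)$, $g_{t,i}'(x)$ (so $f_t(y)\ge f_t(x)+f_t'(x)^T(y-x)$ and $g_{t,i}(y)\ge g_{t,i}(x)+g_{t,i}'(x)^T(y-x)$ for all $y\in\mathcal{X}$), and $G>0$ is a constant with $\|f_t'(x)\|\le G$, $\|g_{t,i}'(x)\|\le G$ for all $t,i,x$. The decisions $X_t$ and the values $f_t(X_t)$, $g_{t,i}(X_t)$ are assumed to be random variables with well defined expectations. $\tilde{\mathcal{A}}$ is the set of all (deterministic)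 $x\in\mathcal{X}$ such that $\mathbb{E}[g_{t,i}(x)]\le0$ for all $i\in\{1,\dots,k\}$ and all $t\in\{0,1,2,\dots\}$. Slater condition: there exist a real number $\eta>0$ and a vector $s\in\mathcal{X}$ such that $g_{t,i}(s)\le-\eta$ for all $t\in\{0,1,2,\dots\}$ and all $i\in\{1,\dots,k\}$. Algorithm with parameters $V>0$, $\alpha>0$. Fix $x_0\in\mathcal{X}$ and set $X_0=x_0$. Virtual queues satisfy $Q_i(0)=Q_i(1)=0$ and, for $t\in\{1,2,3,\dots\}$, $$Q_i(t+1)=\max\left[Q_i(t)+g_{t-1,i}(X_{t-1})+g_{t-1,i}'(X_{t-1})^T(X_t-X_{t-1}),\,0\right].$$ On each slot $t\in\{1,2,3,\dots\}$, $X_t$ is the (unique) minimizer over $x\in\mathcal{X}$ of $$\left[Vf_{t-1}'(X_{t-1})^T+\sum_{i=1}^kQ_i(t)g_{t-1,i}'(X_{t-1})^T\right]x+\alpha\|x-X_{t-1}\|^2.$$ Constants: $B=\frac{k(F+GD)^2}{2}$, $C=B+kF(F+DG)$, $R=\frac{VG^2}{2\alpha}+2F$, $\delta=\sqrt{k}(F+DG)$, and $$\theta=\max\left[\delta,\ \frac{B+RV}{\eta V}+\frac{\alpha D^2}{\eta V(V+1)}+\frac{\delta(V+2)}{2V}\right].$$ $O(1/V)$ denotes a quantity at most $c/V$ for a constant $c$ not depending on $V$ or $T$.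
   Formalization: Part (a) additionally assumes that ω_{t+1} is independent of (ω_s, η_s) for s<t (η may look ahead at most one slot) and that the chosen subgradients are jointly Borel in (x, noise); if η may anticipate all of ω, (a) is false. *)

theory Defs
  imports "HOL-Probability.Probability"
begin

text \<open>
  The realized objective and constraint functions are
  \<open>fhat x (\<eta> t \<xi>)\<close> and \<open>ghat i x (\<omega> t \<xi>)\<close>, where \<open>\<xi>\<close> is a sample point of \<open>M\<close>.
  The chosen subgradient of a realized function is a function of the point \<open>x\<close>
  and of the noise value that determines the realized function; it may also vary with the slot.
\<close>

locale online_model = prob_space M for M :: "'m measure" +
  fixes X :: "(real ^ 'n) set"
    and k :: nat
    and D F G :: real
    and \<omega> \<eta> :: "nat \<Rightarrow> 'm \<Rightarrow> 'w::euclidean_space"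
    and fhat :: "real ^ 'n \<Rightarrow> 'w \<Rightarrow> real"
    and ghat :: "nat \<Rightarrow> real ^ 'n \<Rightarrow> 'w \<Rightarrow> real"
    and fsub :: "nat \<Rightarrow> real ^ 'n \<Rightarrow> 'w \<Rightarrow> real ^ 'n"
    and gsub :: "nat \<Rightarrow> nat \<Rightarrow> real ^ 'n \<Rightarrow> 'w \<Rightarrow> real ^ 'n"
  assumes k_pos: "k > 0"
    and convex_X: "convex X"
    and compact_X: "compact X"
    and D_nonneg: "D \<ge> 0"
    and F_nonneg: "F \<ge> 0"
    and G_pos: "G > 0"
    and diameter: "\<And>x y. x \<in> X \<Longrightarrow> y \<in> X \<Longrightarrow> norm (x - y) \<le> D"
    and rv_\<omega>: "\<And>t. random_variable borel (\<omega> t)"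
    and rv_\<eta>: "\<And>t. random_variable borel (\<eta> t)"
    and indep_\<omega>: "indep_vars (\<lambda>_. borel) \<omega> UNIV"
    and ident_\<omega>: "\<And>t. distr M borel (\<omega> t) = distr M borel (\<omega> 0)"
    and convex_f: "\<And>e. convex_on X (\<lambda>x. fhat x e)"
    and convex_g: "\<And>i w. i \<in> {1..k} \<Longrightarrow> convex_on X (\<lambda>x. ghat i x w)"
    and continuous_f: "\<And>e. continuous_on X (\<lambda>x. fhat x e)"
    and continuous_g: "\<And>i w. i \<in> {1..k} \<Longrightarrow> continuous_on X (\<lambda>x. ghat i x w)"
    and measurable_f: "\<And>x. x \<in> X \<Longrightarrow> fhat x \<in> borel_measurable borel"
    and measurable_g: "\<And>i x. i \<in> {1..k} \<Longrightarrow> x \<in> X \<Longrightarrow> ghat i x \<in> borel_measurable borel"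
    and bound_f: "\<And>t x \<xi>. x \<in> X \<Longrightarrow> \<xi> \<in> space M \<Longrightarrow> \<bar>fhat x (\<eta> t \<xi>)\<bar> \<le> F"
    and bound_g: "\<And>t i x \<xi>. i \<in> {1..k} \<Longrightarrow> x \<in> X \<Longrightarrow> \<xi> \<in> space M \<Longrightarrow> \<bar>ghat i x (\<omega> t \<xi>)\<bar> \<le> F"
    and subgradient_f: "\<And>t x y \<xi>. x \<in> X \<Longrightarrow> y \<in> X \<Longrightarrow> \<xi> \<in> space M \<Longrightarrow>
          fhat y (\<eta> t \<xi>) \<ge> fhat x (\<eta> t \<xi>) + fsub t x (\<eta> t \<xi>) \<bullet> (y - x)"
    and subgradient_g: "\<And>t i x y \<xi>. i \<in> {1..k} \<Longrightarrow> x \<in> X \<Longrightarrow> y \<in> X \<Longrightarrow> \<xi> \<in> space M \<Longrightarrow>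
          ghat i y (\<omega> t \<xi>) \<ge> ghat i x (\<omega> t \<xi>) + gsub t i x (\<omega> t \<xi>) \<bullet> (y - x)"
    and bound_fsub: "\<And>t x \<xi>. x \<in> X \<Longrightarrow> \<xi> \<in> space M \<Longrightarrow> norm (fsub t x (\<eta> t \<xi>)) \<le> G"
    and bound_gsub: "\<And>t i x \<xi>. i \<in> {1..k} \<Longrightarrow> x \<in> X \<Longrightarrow> \<xi> \<in> space M \<Longrightarrow>
          norm (gsub t i x (\<omega> t \<xi>)) \<le> G"

text \<open>
  Without a restriction on how \<open>\<eta>\<close> may anticipate \<open>\<omega>\<close>, the queues and the later constraint
  functions can be correlated and the objective bound fails. The second conjunct lets \<open>\<eta> s\<close>
  depend in any way on \<open>\<omega> 0, \<dots>, \<omega> (s + 1)\<close> (and on other randomness), so it is weaker than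
  requiring \<open>\<eta> s\<close> to use only \<open>\<omega> 0, \<dots>, \<omega> s\<close>; the summand \<open>k * F * (F + D * G)\<close>
  of the constant \<open>C\<close> pays for the one slot of look-ahead. The first conjunct makes
  the decisions measurable functions of the past noise.
\<close>

definition causal_information ::
  "'m measure \<Rightarrow> (real ^ 'n) set \<Rightarrow> nat \<Rightarrow> (nat \<Rightarrow> 'm \<Rightarrow> 'w::euclidean_space) \<Rightarrow> (nat \<Rightarrow> 'm \<Rightarrow> 'w) \<Rightarrow>
   (nat \<Rightarrow> real ^ 'n \<Rightarrow> 'w \<Rightarrow> real ^ 'n) \<Rightarrow>
   (nat \<Rightarrow> nat \<Rightarrow> real ^ 'n \<Rightarrow> 'w \<Rightarrow> real ^ 'n) \<Rightarrow> bool"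
where
  "causal_information M X k \<omega> \<eta> fsub gsub \<longleftrightarrow>
     (\<forall>t. (\<lambda>(x, e). fsub t x e) \<in> borel_measurable (restrict_space borel X \<Otimes>\<^sub>M borel) \<and>
          (\<forall>i\<in>{1..k}. (\<lambda>(x, w). gsub t i x w)
              \<in> borel_measurable (restrict_space borel X \<Otimes>\<^sub>M borel))) \<and>
     (\<forall>t. prob_space.indep_set M
            (sets (vimage_algebra (space M) (\<omega> (t + 1)) borel))
            (sets (vimage_algebra (space M) (\<lambda>\<xi>. \<lambda>s\<in>{..<t}. (\<omega> s \<xi>, \<eta> s \<xi>))
                     (Pi\<^sub>M {..<t} (\<lambda>_. borel)))))"

definition feasible_set ::
  "'m measure \<Rightarrow> (real ^ 'n) set \<Rightarrow> nat \<Rightarrow> (nat \<Rightarrow> 'm \<Rightarrow> 'w) \<Rightarrow>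
   (nat \<Rightarrow> real ^ 'n \<Rightarrow> 'w \<Rightarrow> real) \<Rightarrow> (real ^ 'n) set"
where
  "feasible_set M X k \<omega> ghat =
     {x \<in> X. \<forall>t. \<forall>i\<in>{1..k}. (LINT \<xi>|M. ghat i x (\<omega> t \<xi>)) \<le> 0}"

definition slater ::
  "'m measure \<Rightarrow> (real ^ 'n) set \<Rightarrow> nat \<Rightarrow> (nat \<Rightarrow> 'm \<Rightarrow> 'w) \<Rightarrow>
   (nat \<Rightarrow> real ^ 'n \<Rightarrow> 'w \<Rightarrow> real) \<Rightarrow> real \<Rightarrow> real ^ 'n \<Rightarrow> bool"
where
  "slater M X k \<omega> ghat \<epsilon> s \<longleftrightarrow>
     \<epsilon> > 0 \<and> s \<in> X \<and> (\<forall>\<xi>\<in>space M. \<forall>t. \<forall>i\<in>{1..k}. ghat i s (\<omega> t \<xi>) \<le> - \<epsilon>)"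

text \<open>One trajectory of the algorithm, for given realized functions. The argument order of the
  queues is \<open>Q i t\<close>.\<close>

definition algorithm_path ::
  "(real ^ 'n) set \<Rightarrow> nat \<Rightarrow>
   (nat \<Rightarrow> real ^ 'n \<Rightarrow> real ^ 'n) \<Rightarrow>
   (nat \<Rightarrow> nat \<Rightarrow> real ^ 'n \<Rightarrow> real) \<Rightarrow>
   (nat \<Rightarrow> nat \<Rightarrow> real ^ 'n \<Rightarrow> real ^ 'n) \<Rightarrow>
   real \<Rightarrow> real \<Rightarrow> real ^ 'n \<Rightarrow> (nat \<Rightarrow> real ^ 'n) \<Rightarrow> (nat \<Rightarrow> nat \<Rightarrow> real) \<Rightarrow> bool"
where
  "algorithm_path X k f' g g' V \<alpha> x0 x Q \<longleftrightarrow>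
     x 0 = x0 \<and>
     (\<forall>i\<in>{1..k}. Q i 0 = 0 \<and> Q i 1 = 0) \<and>
     (\<forall>t\<ge>1. \<forall>i\<in>{1..k}. Q i (t + 1) =
        max (Q i t + g (t - 1) i (x (t - 1)) + g' (t - 1) i (x (t - 1)) \<bullet> (x t - x (t - 1))) 0) \<and>
     (\<forall>t\<ge>1. is_arg_min
        (\<lambda>y. (V *\<^sub>R f' (t - 1) (x (t - 1)) + (\<Sum>i=1..k. Q i t *\<^sub>R g' (t - 1) i (x (t - 1)))) \<bullet> y
              + \<alpha> * (norm (y - x (t - 1)))\<^sup>2)
        (\<lambda>y. y \<in> X) (x t))"

definition algorithm_run ::
  "'m measure \<Rightarrow> (real ^ 'n) set \<Rightarrow> nat \<Rightarrow>
   (nat \<Rightarrow> 'm \<Rightarrow> 'w::euclidean_space) \<Rightarrow> (nat \<Rightarrow> 'm \<Rightarrow> 'w) \<Rightarrow>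
   (real ^ 'n \<Rightarrow> 'w \<Rightarrow> real) \<Rightarrow> (nat \<Rightarrow> real ^ 'n \<Rightarrow> 'w \<Rightarrow> real) \<Rightarrow>
   (nat \<Rightarrow> real ^ 'n \<Rightarrow> 'w \<Rightarrow> real ^ 'n) \<Rightarrow>
   (nat \<Rightarrow> nat \<Rightarrow> real ^ 'n \<Rightarrow> 'w \<Rightarrow> real ^ 'n) \<Rightarrow>
   real \<Rightarrow> real \<Rightarrow> real ^ 'n \<Rightarrow> (nat \<Rightarrow> 'm \<Rightarrow> real ^ 'n) \<Rightarrow> (nat \<Rightarrow> nat \<Rightarrow> 'm \<Rightarrow> real) \<Rightarrow> bool"
where
  "algorithm_run M X k \<omega> \<eta> fhat ghat fsub gsub V \<alpha> x0 Xs Q \<longleftrightarrow>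
     (\<forall>\<xi>\<in>space M. algorithm_path X k
        (\<lambda>t x. fsub t x (\<eta> t \<xi>)) (\<lambda>t i x. ghat i x (\<omega> t \<xi>)) (\<lambda>t i x. gsub t i x (\<omega> t \<xi>))
        V \<alpha> x0 (\<lambda>t. Xs t \<xi>) (\<lambda>i t. Q i t \<xi>)) \<and>
     (\<forall>t. Xs t \<in> borel_measurable M) \<and>
     (\<forall>t. integrable M (\<lambda>\<xi>. fhat (Xs t \<xi>) (\<eta> t \<xi>))) \<and>
     (\<forall>t. \<forall>i\<in>{1..k}. integrable M (\<lambda>\<xi>. ghat i (Xs t \<xi>) (\<omega> t \<xi>)))"

definition B_const :: "nat \<Rightarrow> real \<Rightarrow> real \<Rightarrow> real \<Rightarrow> real" where
  "B_const k D F G = real k * (F + G * D)\<^sup>2 / 2"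

definition C_const :: "nat \<Rightarrow> real \<Rightarrow> real \<Rightarrow> real \<Rightarrow> real" where
  "C_const k D F G = B_const k D F G + real k * F * (F + D * G)"

definition R_const :: "real \<Rightarrow> real \<Rightarrow> real \<Rightarrow> real \<Rightarrow> real" where
  "R_const F G V \<alpha> = V * G\<^sup>2 / (2 * \<alpha>) + 2 * F"

definition \<delta>_const :: "nat \<Rightarrow> real \<Rightarrow> real \<Rightarrow> real \<Rightarrow> real" where
  "\<delta>_const k D F G = sqrt (real k) * (F + D * G)"

text \<open>The argument \<open>\<epsilon>\<close> is the Slater constant.\<close>

definition \<theta>_const :: "nat \<Rightarrow> real \<Rightarrow> real \<Rightarrow> real \<Rightarrow> real \<Rightarrow> real \<Rightarrow> real \<Rightarrow> real" where
  "\<theta>_const k D F G V \<alpha> \<epsilon> =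
     max (\<delta>_const k D F G)
         ((B_const k D F G + R_const F G V \<alpha> * V) / (\<epsilon> * V)
          + \<alpha> * D\<^sup>2 / (\<epsilon> * V * (V + 1))
          + \<delta>_const k D F G * (V + 2) / (2 * V))"

end

theory Submission
  imports Defs
begin

text \<open>
  The algorithm is a drift-plus-penalty method. Half the squared Euclidean length of the queue
  vector is a Lyapunov function, and each decision minimizes a proximal upper bound of
  (one-slot drift) + \<open>V\<close> * (linearized objective). The proximal objective is a multiple of a
  squared distance, so a decision is a projection onto \<open>X\<close>, and projections gain an extra
  \<open>\<alpha> * (norm (y - z))\<^sup>2\<close> against every competitor \<open>y\<close> (\<open>proximal_step_pushback\<close>). Together with
  the subgradient inequalities this gives one inequality valid on every sample path and for
  every \<open>y \<in> X\<close> (\<open>drift_plus_penalty\<close>):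
  drift + \<open>V * f t (x t)\<close> is at most a constant + \<open>V * f t y\<close> + \<open>\<Sum>i. Q i (t + 1) * g t i y\<close>
  + a telescoping distance term. Both halves of the theorem come from it.

  For the objective, take \<open>y\<close> feasible in expectation and sum. The drifts and distances telescope,
  and what remains is the expectation of \<open>Q i (t + 1) * g t i y\<close>. These two factors may be
  correlated, since \<open>\<eta>\<close> is allowed to look one slot ahead. The queue of the slot before, however,
  is a measurable function of noise that is independent of \<open>g t i y\<close>
  (\<open>decisions_queues_measurable_past\<close>), so with it in place of \<open>Q i (t + 1)\<close> the expected product
  is nonpositive, and the replacement costs at most \<open>F * (F + D * G)\<close>
  (\<open>expected_queue_term_le\<close>).

  For the constraints, take \<open>y\<close> to be a Slater point. Then the drift contains
  \<open>- \<epsilon> * queue_norm\<close>, which over \<open>V + 1\<close> slots beats all other terms once the queues are longer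
  than \<open>\<theta> * V\<close>; hence they never are (\<open>queue_norm_bounded\<close>). A queue accumulates the linearized
  constraint values, so the sum of the true values is at most the queue plus \<open>G\<close> times the length
  of the path of decisions; with \<open>\<alpha> = V\<^sup>2\<close> and queues of order \<open>V\<close>, a single decision moves by
  \<open>O(1/V)\<close> only (\<open>constraint_violation_bound\<close>).
\<close>

section \<open>Proximal linear steps as projections\<close>

text \<open>
  Completing the square shows that the proximal objective is \<open>\<alpha>\<close> times the squared distance to a
  displaced centre, up to a constant. This is used for the variational inequality of the minimizer
  and for the measurability of the decisions.
\<close>
lemma proximal_step_eq_projection:
  fixes X :: "'a::euclidean_space set"
  assumes "convex X" "closed X" "\<alpha> > 0"
    and min: "is_arg_min (\<lambda>y. c \<bullet> y + \<alpha> * (norm (y - a))\<^sup>2) (\<lambda>y. y \<in> X) z"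
  shows "z = closest_point X (a - (1 / (2 * \<alpha>)) *\<^sub>R c)"
proof -
  let ?p = "a - (1 / (2 * \<alpha>)) *\<^sub>R c"
  have sq: "c \<bullet> y + \<alpha> * (norm (y - a))\<^sup>2 = \<alpha> * (dist ?p y)\<^sup>2 + (c \<bullet> a - (c \<bullet> c) / (4 * \<alpha>))" for y
    using \<open>\<alpha> > 0\<close>
    unfolding dist_norm power2_norm_eq_inner inner_diff_left inner_diff_right
      inner_scaleR_left inner_scaleR_right
    by (simp add: inner_commute) (simp add: field_simps)
  have "dist ?p z \<le> dist ?p y" if "y \<in> X" for y
  proof -
    have "c \<bullet> z + \<alpha> * (norm (z - a))\<^sup>2 \<le> c \<bullet> y + \<alpha> * (norm (y - a))\<^sup>2"
      using min that by (auto simp: is_arg_min_def not_less)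
    then have "(dist ?p z)\<^sup>2 \<le> (dist ?p y)\<^sup>2"
      unfolding sq using \<open>\<alpha> > 0\<close> by simp
    then show ?thesis
      by (rule power2_le_imp_le) simp
  qed
  moreover have "z \<in> X"
    using min by (simp add: is_arg_min_def)
  ultimately show ?thesis
    using closest_point_unique[OF \<open>convex X\<close> \<open>closed X\<close>] by blast
qed

text \<open>
  The obtuse-angle property of the projection turns minimality into a quadratic gain: the term
  \<open>\<alpha> * (norm (y - z))\<^sup>2\<close> on the left is what makes the distances to a fixed competitor telescope
  along a trajectory.
\<close>
lemma proximal_step_pushback:
  fixes X :: "'a::euclidean_space set"
  assumes "convex X" "closed X" "\<alpha> > 0"
    and min: "is_arg_min (\<lambda>y. c \<bullet> y + \<alpha> * (norm (y - a))\<^sup>2) (\<lambda>y. y \<in> X) z"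
    and "y \<in> X"
  shows "c \<bullet> z + \<alpha> * (norm (z - a))\<^sup>2 + \<alpha> * (norm (y - z))\<^sup>2 \<le> c \<bullet> y + \<alpha> * (norm (y - a))\<^sup>2"
proof -
  have "(a - (1 / (2 * \<alpha>)) *\<^sub>R c - z) \<bullet> (y - z) \<le> 0"
    using closest_point_dot[OF assms(1,2,5)] proximal_step_eq_projection[OF assms(1-4)] by metis
  then have "2 * \<alpha> * ((a - (1 / (2 * \<alpha>)) *\<^sub>R c - z) \<bullet> (y - z)) \<le> 0"
    using \<open>\<alpha> > 0\<close> by (simp add: mult_le_0_iff)
  moreover have "2 * \<alpha> * ((a - (1 / (2 * \<alpha>)) *\<^sub>R c - z) \<bullet> (y - z))
      = c \<bullet> z + \<alpha> * (norm (z - a))\<^sup>2 + \<alpha> * (norm (y - z))\<^sup>2 - (c \<bullet> y + \<alpha> * (norm (y - a))\<^sup>2)"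
    using \<open>\<alpha> > 0\<close>
    unfolding power2_norm_eq_inner inner_diff_left inner_diff_right inner_scaleR_left
    by (simp add: inner_commute) (simp add: field_simps)
  ultimately show ?thesis by linarith
qed

text \<open>The pushback inequality against the centre \<open>a\<close> itself, combined with Cauchy-Schwarz.\<close>
lemma proximal_step_length:
  fixes X :: "'a::euclidean_space set"
  assumes "convex X" "closed X" "\<alpha> > 0"
    and min: "is_arg_min (\<lambda>y. c \<bullet> y + \<alpha> * (norm (y - a))\<^sup>2) (\<lambda>y. y \<in> X) z"
    and "a \<in> X"
  shows "norm (z - a) \<le> norm c / (2 * \<alpha>)"
proof -
  have "2 * \<alpha> * (norm (z - a))\<^sup>2 \<le> c \<bullet> (a - z)"
    using proximal_step_pushback[OF assms] by (simp add: inner_diff_right norm_minus_commute)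
  also have "\<dots> \<le> norm c * norm (z - a)"
    using norm_cauchy_schwarz[of c "a - z"] by (simp add: norm_minus_commute)
  finally have "norm (z - a) * (2 * \<alpha> * norm (z - a)) \<le> norm (z - a) * norm c"
    by (simp add: power2_eq_square mult_ac)
  then have "2 * \<alpha> * norm (z - a) \<le> norm c"
    by (cases "norm (z - a) = 0") simp_all
  then show ?thesis
    using \<open>\<alpha> > 0\<close> by (simp add: field_simps)
qed

section \<open>The drift-plus-penalty inequality on a trajectory\<close>

text \<open>
  A single sample path: the random functions are replaced by fixed sequences \<open>f\<close> and \<open>g\<close>.
  The recursions are shifted by one slot throughout, so that slot \<open>t\<close> pairs the functions with
  index \<open>t\<close> with the decision \<open>x t\<close>, the queue \<open>Q i (t + 1)\<close> and the next decision \<open>x (t + 1)\<close>.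
\<close>
locale algorithm_trajectory =
  fixes X :: "(real ^ 'n) set"
    and k :: nat
    and D F G V \<alpha> :: real
    and f :: "nat \<Rightarrow> real ^ 'n \<Rightarrow> real"
    and f' :: "nat \<Rightarrow> real ^ 'n \<Rightarrow> real ^ 'n"
    and g :: "nat \<Rightarrow> nat \<Rightarrow> real ^ 'n \<Rightarrow> real"
    and g' :: "nat \<Rightarrow> nat \<Rightarrow> real ^ 'n \<Rightarrow> real ^ 'n"
    and x0 :: "real ^ 'n"
    and x :: "nat \<Rightarrow> real ^ 'n"
    and Q :: "nat \<Rightarrow> nat \<Rightarrow> real"
  assumes convex_X: "convex X"
    and compact_X: "compact X"
    and D_nonneg: "D \<ge> 0"
    and F_nonneg: "F \<ge> 0"
    and G_nonneg: "G \<ge> 0"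
    and V_pos: "V > 0"
    and \<alpha>_pos: "\<alpha> > 0"
    and x0_in: "x0 \<in> X"
    and diameter: "\<And>y z. y \<in> X \<Longrightarrow> z \<in> X \<Longrightarrow> norm (y - z) \<le> D"
    and bound_f: "\<And>t y. y \<in> X \<Longrightarrow> \<bar>f t y\<bar> \<le> F"
    and bound_g: "\<And>t i y. i \<in> {1..k} \<Longrightarrow> y \<in> X \<Longrightarrow> \<bar>g t i y\<bar> \<le> F"
    and subgradient_f: "\<And>t y z. y \<in> X \<Longrightarrow> z \<in> X \<Longrightarrow> f t z \<ge> f t y + f' t y \<bullet> (z - y)"
    and subgradient_g: "\<And>t i y z. i \<in> {1..k} \<Longrightarrow> y \<in> X \<Longrightarrow> z \<in> X \<Longrightarrow>
          g t i z \<ge> g t i y + g' t i y \<bullet> (z - y)"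
    and bound_f': "\<And>t y. y \<in> X \<Longrightarrow> norm (f' t y) \<le> G"
    and bound_g': "\<And>t i y. i \<in> {1..k} \<Longrightarrow> y \<in> X \<Longrightarrow> norm (g' t i y) \<le> G"
    and path: "algorithm_path X k f' g g' V \<alpha> x0 x Q"
begin

definition linearized :: "nat \<Rightarrow> nat \<Rightarrow> real ^ 'n \<Rightarrow> real" where
  "linearized t i y = g t i (x t) + g' t i (x t) \<bullet> (y - x t)"

definition search_direction :: "nat \<Rightarrow> real ^ 'n" where
  "search_direction t = V *\<^sub>R f' t (x t) + (\<Sum>i=1..k. Q i (t + 1) *\<^sub>R g' t i (x t))"

definition queue_norm :: "nat \<Rightarrow> real" where
  "queue_norm t = L2_set (\<lambda>i. Q i t) {1..k}"

lemma Q_first: "i \<in> {1..k} \<Longrightarrow> Q i (Suc 0) = 0"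
  using path by (simp add: algorithm_path_def)

lemma Q_step:
  assumes "i \<in> {1..k}"
  shows "Q i (t + 2) = max (Q i (t + 1) + linearized t i (x (t + 1))) 0"
proof -
  have "1 \<le> Suc t" by simp
  have "Q i (Suc t + 1) = max (Q i (Suc t) + g (Suc t - 1) i (x (Suc t - 1))
      + g' (Suc t - 1) i (x (Suc t - 1)) \<bullet> (x (Suc t) - x (Suc t - 1))) 0"
    using path assms \<open>1 \<le> Suc t\<close> unfolding algorithm_path_def by blast
  then show ?thesis
    by (simp add: linearized_def add.assoc)
qed

lemma x_step_min:
  "is_arg_min (\<lambda>y. search_direction t \<bullet> y + \<alpha> * (norm (y - x t))\<^sup>2) (\<lambda>y. y \<in> X) (x (t + 1))"
proof -
  have "1 \<le> Suc t" by simp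
  have "is_arg_min
        (\<lambda>y. (V *\<^sub>R f' (Suc t - 1) (x (Suc t - 1))
              + (\<Sum>i=1..k. Q i (Suc t) *\<^sub>R g' (Suc t - 1) i (x (Suc t - 1)))) \<bullet> y
              + \<alpha> * (norm (y - x (Suc t - 1)))\<^sup>2)
        (\<lambda>y. y \<in> X) (x (Suc t))"
    using path \<open>1 \<le> Suc t\<close> unfolding algorithm_path_def by blast
  then show ?thesis
    by (simp add: search_direction_def)
qed

lemma x_in: "x t \<in> X"
proof (cases t)
  case 0
  then show ?thesis
    using path x0_in by (simp add: algorithm_path_def)
next
  case (Suc n)
  then show ?thesis
    using x_step_min[of n] by (simp add: is_arg_min_def)
qed

lemma x_step_eq: "x (t + 1) = closest_point X (x t - (1 / (2 * \<alpha>)) *\<^sub>R search_direction t)"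
  by (intro proximal_step_eq_projection convex_X compact_imp_closed compact_X \<alpha>_pos x_step_min)

lemma Q_nonneg:
  assumes "i \<in> {1..k}"
  shows "0 \<le> Q i (t + 1)"
proof (cases t)
  case 0
  then show ?thesis
    using Q_first[OF assms] by simp
next
  case (Suc n)
  then show ?thesis
    using Q_step[OF assms, of n] by simp
qed

lemma linearized_le:
  assumes "i \<in> {1..k}" "y \<in> X"
  shows "linearized t i y \<le> g t i y"
  using subgradient_g[OF assms(1) x_in assms(2)] by (simp add: linearized_def)

lemma abs_linearized_le:
  assumes "i \<in> {1..k}" "y \<in> X"
  shows "\<bar>linearized t i y\<bar> \<le> F + G * D"
proof -
  have "\<bar>g' t i (x t) \<bullet> (y - x t)\<bar> \<le> norm (g' t i (x t)) * norm (y - x t)"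
    by (rule Cauchy_Schwarz_ineq2)
  also have "\<dots> \<le> G * D"
    by (intro mult_mono bound_g' diameter x_in assms norm_ge_zero G_nonneg)
  finally show ?thesis
    using bound_g[OF assms(1) x_in[of t], of t] unfolding linearized_def by linarith
qed

lemma abs_Q_diff_le:
  assumes "i \<in> {1..k}"
  shows "\<bar>Q i (t + 2) - Q i (t + 1)\<bar> \<le> F + G * D"
  using Q_step[OF assms, of t] Q_nonneg[OF assms, of t] abs_linearized_le[OF assms x_in, of t "t + 1"]
  by (auto simp: max_def split: if_splits)

lemma Q_le_linear:
  assumes "i \<in> {1..k}"
  shows "Q i (t + 1) \<le> real t * (F + G * D)"
proof (induction t)
  case 0
  then show ?case
    using Q_first[OF assms] by simp
next
  case (Suc t)
  then show ?case
    using abs_Q_diff_le[OF assms, of t] by (simp add: algebra_simps)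
qed

lemma queue_norm_nonneg: "0 \<le> queue_norm t"
  unfolding queue_norm_def by (rule L2_set_nonneg)

lemma queue_norm_first: "queue_norm 1 = 0"
  by (simp add: queue_norm_def L2_set_def Q_first)

lemma queue_norm_sq: "(queue_norm t)\<^sup>2 = (\<Sum>i=1..k. (Q i t)\<^sup>2)"
  unfolding queue_norm_def L2_set_def by (simp add: sum_nonneg)

lemma queue_norm_le_sum: "queue_norm (t + 1) \<le> (\<Sum>i=1..k. Q i (t + 1))"
  unfolding queue_norm_def by (rule L2_set_le_sum) (rule Q_nonneg)

lemma sum_Q_le_queue_norm: "(\<Sum>i=1..k. Q i (t + 1)) \<le> sqrt (real k) * queue_norm (t + 1)"
proof -
  have "(\<Sum>i=1..k. Q i (t + 1)) = (\<Sum>i=1..k. \<bar>1\<bar> * \<bar>Q i (t + 1)\<bar>)"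
    using Q_nonneg by (intro sum.cong) auto
  also have "\<dots> \<le> L2_set (\<lambda>_. 1) {1..k} * queue_norm (t + 1)"
    unfolding queue_norm_def by (rule L2_set_mult_ineq)
  finally show ?thesis
    by (simp add: L2_set_def)
qed

lemma abs_queue_norm_diff_le:
  "\<bar>queue_norm (t + 2) - queue_norm (t + 1)\<bar> \<le> sqrt (real k) * (F + G * D)"
proof -
  let ?d = "L2_set (\<lambda>i. Q i (t + 2) - Q i (t + 1)) {1..k}"
  have fgd: "0 \<le> F + G * D"
    using F_nonneg G_nonneg D_nonneg by simp
  have "queue_norm (t + 2) \<le> queue_norm (t + 1) + ?d"
    using L2_set_triangle_ineq[of "\<lambda>i. Q i (t + 1)" "\<lambda>i. Q i (t + 2) - Q i (t + 1)" "{1..k}"]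
    by (simp add: queue_norm_def)
  moreover have "queue_norm (t + 1) \<le> queue_norm (t + 2) + ?d"
    using L2_set_triangle_ineq[of "\<lambda>i. Q i (t + 2)" "\<lambda>i. Q i (t + 1) - Q i (t + 2)" "{1..k}"]
    by (simp add: queue_norm_def L2_set_def power2_commute)
  moreover have "?d \<le> sqrt (real k) * (F + G * D)"
  proof -
    have "?d \<le> L2_set (\<lambda>i. F + G * D) {1..k}"
      unfolding L2_set_def
      by (intro real_sqrt_le_mono sum_mono) (metis abs_Q_diff_le abs_le_square_iff abs_of_nonneg fgd)
    then show ?thesis
      using fgd by (simp add: L2_set_def real_sqrt_mult)
  qed
  ultimately show ?thesis by linarith
qed

lemma queue_norm_Lipschitz:
  "\<bar>queue_norm (t + m + 1) - queue_norm (t + 1)\<bar> \<le> real m * (sqrt (real k) * (F + G * D))"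
proof (induction m)
  case (Suc m)
  then show ?case
    using abs_queue_norm_diff_le[of "t + m"] by (simp add: algebra_simps)
qed simp

text \<open>
  Truncating a queue at zero can only decrease its square, so it suffices to expand the square of
  the untruncated update.
\<close>
lemma drift_bound:
  "(queue_norm (t + 2))\<^sup>2 / 2 - (queue_norm (t + 1))\<^sup>2 / 2
     \<le> B_const k D F G + (\<Sum>i=1..k. Q i (t + 1) * linearized t i (x (t + 1)))"
proof -
  have "(Q i (t + 2))\<^sup>2 \<le> (Q i (t + 1))\<^sup>2 + (F + G * D)\<^sup>2 + 2 * (Q i (t + 1) * linearized t i (x (t + 1)))"
    if i: "i \<in> {1..k}" for i
  proof -
    have "(Q i (t + 2))\<^sup>2 \<le> (Q i (t + 1) + linearized t i (x (t + 1)))\<^sup>2"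
      unfolding Q_step[OF i] by (simp add: max_def)
    moreover have "(linearized t i (x (t + 1)))\<^sup>2 \<le> (F + G * D)\<^sup>2"
      using abs_linearized_le[OF i x_in] by (metis abs_ge_zero power2_abs power_mono)
    ultimately show ?thesis
      by (simp add: power2_sum)
  qed
  then have "(\<Sum>i=1..k. (Q i (t + 2))\<^sup>2)
      \<le> (\<Sum>i=1..k. (Q i (t + 1))\<^sup>2 + (F + G * D)\<^sup>2 + 2 * (Q i (t + 1) * linearized t i (x (t + 1))))"
    by (rule sum_mono)
  also have "\<dots> = (\<Sum>i=1..k. (Q i (t + 1))\<^sup>2) + 2 * B_const k D F G
      + 2 * (\<Sum>i=1..k. Q i (t + 1) * linearized t i (x (t + 1)))"
    by (simp add: sum.distrib sum_distrib_left B_const_def)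
  finally show ?thesis
    by (simp add: queue_norm_sq)
qed

text \<open>
  The central inequality. The linearizations in the drift bound and in the objective add up to the
  function minimized by \<open>x (t + 1)\<close>; the pushback inequality passes from \<open>x (t + 1)\<close> to an
  arbitrary \<open>y\<close>, where convexity replaces linearizations by true values. The remaining first-order
  change of \<open>f\<close> is absorbed by \<open>\<alpha> * (norm (x (t + 1) - x t))\<^sup>2\<close>, at the price of
  \<open>V\<^sup>2 * G\<^sup>2 / (4 * \<alpha>)\<close>.
\<close>
lemma drift_plus_penalty:
  assumes y: "y \<in> X"
  shows "(queue_norm (t + 2))\<^sup>2 / 2 - (queue_norm (t + 1))\<^sup>2 / 2 + V * f t (x t)
     \<le> B_const k D F G + V\<^sup>2 * G\<^sup>2 / (4 * \<alpha>) + V * f t y + (\<Sum>i=1..k. Q i (t + 1) * g t i y)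
       + \<alpha> * ((norm (y - x t))\<^sup>2 - (norm (y - x (t + 1)))\<^sup>2)"
proof -
  let ?z = "x (t + 1)" and ?a = "x t"
  define r where "r = norm (?z - ?a)"
  \<comment> \<open>Along displacements from \<open>x t\<close>, the search direction measures the change of the linearized
    objective plus the queue-weighted linearized constraints.\<close>
  have split: "search_direction t \<bullet> (w - ?a)
      = V * (f' t ?a \<bullet> (w - ?a)) + (\<Sum>i=1..k. Q i (t + 1) * linearized t i w)
        - (\<Sum>i=1..k. Q i (t + 1) * g t i ?a)" for w
    by (simp add: search_direction_def linearized_def inner_add_left inner_sum_left sum.distrib
        distrib_left)
  have "search_direction t \<bullet> ?z + \<alpha> * (norm (?z - ?a))\<^sup>2 + \<alpha> * (norm (y - ?z))\<^sup>2
      \<le> search_direction t \<bullet> y + \<alpha> * (norm (y - ?a))\<^sup>2"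
    by (intro proximal_step_pushback[OF convex_X compact_imp_closed[OF compact_X] \<alpha>_pos x_step_min y])
  then have "search_direction t \<bullet> (?z - ?a) + \<alpha> * r\<^sup>2 + \<alpha> * (norm (y - ?z))\<^sup>2
      \<le> search_direction t \<bullet> (y - ?a) + \<alpha> * (norm (y - ?a))\<^sup>2"
    by (simp add: inner_diff_right r_def)
  then have step: "V * (f' t ?a \<bullet> (?z - ?a)) + (\<Sum>i=1..k. Q i (t + 1) * linearized t i ?z)
        + \<alpha> * r\<^sup>2 + \<alpha> * (norm (y - ?z))\<^sup>2
      \<le> V * (f' t ?a \<bullet> (y - ?a)) + (\<Sum>i=1..k. Q i (t + 1) * linearized t i y)
        + \<alpha> * (norm (y - ?a))\<^sup>2"
    unfolding split by linarith
  have "V * (f' t ?a \<bullet> (y - ?a)) \<le> V * (f t y - f t ?a)"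
    using subgradient_f[OF x_in y, of t t] V_pos by simp
  moreover have "(\<Sum>i=1..k. Q i (t + 1) * linearized t i y) \<le> (\<Sum>i=1..k. Q i (t + 1) * g t i y)"
    by (intro sum_mono mult_left_mono linearized_le Q_nonneg y)
  moreover have "- (V\<^sup>2 * G\<^sup>2 / (4 * \<alpha>)) \<le> V * (f' t ?a \<bullet> (?z - ?a)) + \<alpha> * r\<^sup>2"
  proof -
    have "\<bar>f' t ?a \<bullet> (?z - ?a)\<bar> \<le> G * r"
      using Cauchy_Schwarz_ineq2[of "f' t ?a" "?z - ?a"] bound_f'[OF x_in[of t], of t]
      unfolding r_def by (meson mult_right_mono norm_ge_zero order_trans)
    then have "- (V * (G * r)) \<le> V * (f' t ?a \<bullet> (?z - ?a))"
      using V_pos by (metis abs_le_D2 minus_le_iff mult_le_cancel_left_pos mult_minus_right)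
    moreover have "V * (G * r) \<le> V\<^sup>2 * G\<^sup>2 / (4 * \<alpha>) + \<alpha> * r\<^sup>2"
    proof -
      \<comment> \<open>The square vanishes at \<open>r = V * G / (2 * \<alpha>)\<close>, where the bound is tight.\<close>
      have "0 \<le> (V * G - 2 * \<alpha> * r)\<^sup>2 / (4 * \<alpha>)"
        using \<alpha>_pos by simp
      also have "\<dots> = V\<^sup>2 * G\<^sup>2 / (4 * \<alpha>) + \<alpha> * r\<^sup>2 - V * (G * r)"
        using \<alpha>_pos by (simp add: power2_eq_square field_simps)
      finally show ?thesis by simp
    qed
    ultimately show ?thesis by linarith
  qed
  moreover note drift_bound[of t] step
  ultimately show ?thesis
    by (simp add: algebra_simps)
qed

lemma regret_with_queue_terms:
  assumes y: "y \<in> X"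
  shows "V * (\<Sum>t<T. f t (x t)) \<le> V * (\<Sum>t<T. f t y)
      + real T * (B_const k D F G + V\<^sup>2 * G\<^sup>2 / (4 * \<alpha>))
      + (\<Sum>t<T. \<Sum>i=1..k. Q i (t + 1) * g t i y) + \<alpha> * D\<^sup>2"
proof -
  define K where "K = B_const k D F G + V\<^sup>2 * G\<^sup>2 / (4 * \<alpha>)"
  have "(queue_norm (T + 1))\<^sup>2 / 2 + V * (\<Sum>t<T. f t (x t)) + \<alpha> * (norm (y - x T))\<^sup>2
      \<le> V * (\<Sum>t<T. f t y) + real T * K
        + (\<Sum>t<T. \<Sum>i=1..k. Q i (t + 1) * g t i y) + \<alpha> * (norm (y - x 0))\<^sup>2"
  proof (induction T)
    case 0
    then show ?case
      using queue_norm_first by simp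
  next
    case (Suc T)
    then show ?case
      using drift_plus_penalty[OF y, of T, folded K_def] by (simp add: algebra_simps)
  qed
  moreover have "\<alpha> * (norm (y - x 0))\<^sup>2 \<le> \<alpha> * D\<^sup>2"
    using diameter[OF y x_in] \<alpha>_pos by (simp add: power_mono)
  moreover have "0 \<le> (queue_norm (T + 1))\<^sup>2 / 2" "0 \<le> \<alpha> * (norm (y - x T))\<^sup>2"
    using \<alpha>_pos by auto
  ultimately show ?thesis
    unfolding K_def by linarith
qed

section \<open>Queue and constraint bounds from a Slater point\<close>

text \<open>
  At a Slater point the queue terms of the central inequality are at most \<open>- \<epsilon>\<close> times the sum of
  the queues, hence at most \<open>- \<epsilon> * queue_norm\<close>, while the objective terms contribute at most
  \<open>2 * F * V\<close>. Summing over \<open>m\<close> slots pays the distance term \<open>\<alpha> * D\<^sup>2\<close> only once, which is why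
  several slots are needed when \<open>\<alpha>\<close> is of order \<open>V\<^sup>2\<close>.
\<close>
lemma slater_drift:
  assumes s: "s \<in> X" and g_s: "\<And>t i. i \<in> {1..k} \<Longrightarrow> g t i s \<le> - \<epsilon>" and "\<epsilon> > 0"
  shows "(queue_norm (t + m + 1))\<^sup>2 / 2 - (queue_norm (t + 1))\<^sup>2 / 2
     \<le> real m * (B_const k D F G + R_const F G V \<alpha> * V)
       - \<epsilon> * (\<Sum>j<m. queue_norm (t + j + 1)) + \<alpha> * D\<^sup>2"
proof -
  have one: "(queue_norm (t + 2))\<^sup>2 / 2 - (queue_norm (t + 1))\<^sup>2 / 2
     \<le> B_const k D F G + R_const F G V \<alpha> * V - \<epsilon> * queue_norm (t + 1)
       + \<alpha> * ((norm (s - x t))\<^sup>2 - (norm (s - x (t + 1)))\<^sup>2)" for t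
  proof -
    have "(\<Sum>i=1..k. Q i (t + 1) * g t i s) \<le> (\<Sum>i=1..k. Q i (t + 1) * (- \<epsilon>))"
      by (intro sum_mono mult_left_mono g_s Q_nonneg)
    also have "\<dots> = - \<epsilon> * (\<Sum>i=1..k. Q i (t + 1))"
      by (simp add: sum_distrib_left mult.commute sum_negf)
    also have "\<dots> \<le> - \<epsilon> * queue_norm (t + 1)"
      using queue_norm_le_sum[of t] \<open>\<epsilon> > 0\<close> by simp
    finally have "(\<Sum>i=1..k. Q i (t + 1) * g t i s) \<le> - \<epsilon> * queue_norm (t + 1)" .
    moreover have "V * f t s \<le> V * F" "- (V * F) \<le> V * f t (x t)"
      using bound_f[OF s, of t] bound_f[OF x_in[of t], of t] V_pos
        mult_left_mono[of "f t s" F V] mult_left_mono[of "- F" "f t (x t)" V]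
      by linarith+
    moreover have "V\<^sup>2 * G\<^sup>2 / (4 * \<alpha>) + 2 * (V * F) \<le> R_const F G V \<alpha> * V"
      using \<alpha>_pos V_pos G_nonneg by (simp add: R_const_def power2_eq_square field_simps)
    ultimately show ?thesis
      using drift_plus_penalty[OF s, of t] by linarith
  qed
  have "(queue_norm (t + m + 1))\<^sup>2 / 2 + \<alpha> * (norm (s - x (t + m)))\<^sup>2
     \<le> (queue_norm (t + 1))\<^sup>2 / 2 + real m * (B_const k D F G + R_const F G V \<alpha> * V)
       - \<epsilon> * (\<Sum>j<m. queue_norm (t + j + 1)) + \<alpha> * (norm (s - x t))\<^sup>2"
  proof (induction m)
    case (Suc m)
    then show ?case
      using one[of "t + m"] by (simp add: algebra_simps)
  qed simp
  moreover have "\<alpha> * (norm (s - x t))\<^sup>2 \<le> \<alpha> * D\<^sup>2"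
    using diameter[OF s x_in] \<alpha>_pos by (simp add: power_mono)
  moreover have "0 \<le> \<alpha> * (norm (s - x (t + m)))\<^sup>2"
    using \<alpha>_pos by simp
  ultimately show ?thesis
    by linarith
qed

text \<open>
  Up to slot \<open>V + 1\<close> the bound holds because a slot lengthens the queue vector by at most
  \<open>\<delta>\<close> and \<open>\<delta> * V \<le> \<theta> * V\<close>. Later, suppose that the vector is too long now. Looking back over
  \<open>V + 1\<close> slots it cannot have been much shorter, so the total drift over these slots is at most
  \<open>0\<close> by the choice of \<open>\<theta>\<close>. Then the vector was too long \<open>V + 1\<close> slots ago as well, against the
  induction hypothesis. Comparing backwards from the end of the window, rather than forwards from
  its start, is what makes \<open>\<delta> * (V + 2) / 2\<close> the exact correction.
\<close>
lemma queue_norm_bounded: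
  assumes s: "s \<in> X" and g_s: "\<And>t i. i \<in> {1..k} \<Longrightarrow> g t i s \<le> - \<epsilon>" and "\<epsilon> > 0"
    and V: "V = real v"
  shows "queue_norm (t + 1) \<le> \<theta>_const k D F G V \<alpha> \<epsilon> * V"
proof (induction t rule: less_induct)
  case (less t)
  define q where "q = \<theta>_const k D F G V \<alpha> \<epsilon> * V"
  define \<delta> where "\<delta> = \<delta>_const k D F G"
  define K where "K = B_const k D F G + R_const F G V \<alpha> * V"
  have \<delta>_eq: "sqrt (real k) * (F + G * D) = \<delta>"
    by (simp add: \<delta>_def \<delta>_const_def mult.commute)
  have \<delta>_nonneg: "0 \<le> \<delta>"
    unfolding \<delta>_def \<delta>_const_def using F_nonneg G_nonneg D_nonneg by simp
  have q_ge1: "\<delta> * V \<le> q"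
    unfolding q_def \<theta>_const_def \<delta>_def using V_pos by simp
  have "(K / (\<epsilon> * V) + \<alpha> * D\<^sup>2 / (\<epsilon> * V * (V + 1)) + \<delta> * (V + 2) / (2 * V)) * V \<le> q"
    unfolding q_def \<theta>_const_def K_def \<delta>_def using V_pos by simp
  \<comment> \<open>Clearing denominators in the second alternative of \<open>\<theta>\<close> gives exactly what the drift over
    \<open>V + 1\<close> slots has to outweigh.\<close>
  then have "\<epsilon> * (V + 1) * ((K / (\<epsilon> * V) + \<alpha> * D\<^sup>2 / (\<epsilon> * V * (V + 1)) + \<delta> * (V + 2) / (2 * V)) * V)
      \<le> \<epsilon> * (V + 1) * q"
    using V_pos \<open>\<epsilon> > 0\<close> by simp
  moreover have "\<epsilon> * (V + 1) * ((K / (\<epsilon> * V) + \<alpha> * D\<^sup>2 / (\<epsilon> * V * (V + 1)) + \<delta> * (V + 2) / (2 * V)) * V)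
      = (V + 1) * K + \<alpha> * D\<^sup>2 + \<epsilon> * (\<delta> * (V + 1) * (V + 2) / 2)"
  proof -
    have "V + 1 \<noteq> 0" using V_pos by linarith
    then show ?thesis using V_pos \<open>\<epsilon> > 0\<close>
      by (simp add: divide_simps) (simp add: algebra_simps)
  qed
  ultimately have q_ge2: "(V + 1) * K + \<alpha> * D\<^sup>2 + \<epsilon> * (\<delta> * (V + 1) * (V + 2) / 2) \<le> \<epsilon> * (V + 1) * q"
    by simp
  show ?case
  proof (cases "t \<le> v")
    case True
    have "queue_norm (t + 1) \<le> real t * \<delta>"
      using queue_norm_Lipschitz[of 0 t] queue_norm_first by (simp add: \<delta>_eq)
    also have "\<dots> \<le> \<delta> * V"
      using True V \<delta>_nonneg by (simp add: mult.commute mult_left_mono)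
    also note q_ge1
    finally show ?thesis by (simp add: q_def)
  next
    case False
    then obtain u where t: "t = u + (v + 1)"
      by (metis add.commute less_eq_Suc_le not_le le_Suc_ex Suc_eq_plus1)
    show ?thesis
    proof (rule ccontr)
      assume "\<not> queue_norm (t + 1) \<le> \<theta>_const k D F G V \<alpha> \<epsilon> * V"
      then have large: "q < queue_norm (t + 1)"
        by (simp add: q_def)
      have lower: "q - (V + 1 - real j) * \<delta> \<le> queue_norm (u + j + 1)" if "j < v + 1" for j
      proof -
        have "(u + j) + (v + 1 - j) + 1 = t + 1"
          using that t by simp
        then have "\<bar>queue_norm (t + 1) - queue_norm (u + j + 1)\<bar> \<le> real (v + 1 - j) * \<delta>"
          using queue_norm_Lipschitz[of "u + j" "v + 1 - j"] by (simp add: \<delta>_eq)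
        moreover have "real (v + 1 - j) = V + 1 - real j"
          using that V by simp
        ultimately show ?thesis
          using large by simp
      qed
      have "(\<Sum>j<m. c - (a - real j) * \<delta>) = real m * c - \<delta> * (real m * a - real m * (real m - 1) / 2)"
        for m and a c :: real
        by (induction m) (simp_all add: field_simps)
      \<comment> \<open>The deficits \<open>V + 1 - j\<close> for \<open>j \<le> V\<close> add up to \<open>(V + 1) * (V + 2) / 2\<close>.\<close>
      from this[of q "V + 1" "v + 1"]
      have "(V + 1) * q - \<delta> * (V + 1) * (V + 2) / 2 = (\<Sum>j<v+1. q - (V + 1 - real j) * \<delta>)"
        by (simp add: V field_simps)
      also have "\<dots> \<le> (\<Sum>j<v+1. queue_norm (u + j + 1))"
        by (intro sum_mono lower) simp
      finally have "\<epsilon> * ((V + 1) * q - \<delta> * (V + 1) * (V + 2) / 2)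
          \<le> \<epsilon> * (\<Sum>j<v+1. queue_norm (u + j + 1))"
        using \<open>\<epsilon> > 0\<close> by simp
      moreover have "(queue_norm (t + 1))\<^sup>2 / 2 - (queue_norm (u + 1))\<^sup>2 / 2
          \<le> (V + 1) * K - \<epsilon> * (\<Sum>j<v+1. queue_norm (u + j + 1)) + \<alpha> * D\<^sup>2"
        using slater_drift[OF s g_s \<open>\<epsilon> > 0\<close>, of u "v + 1"] by (simp add: t V K_def add_ac)
      ultimately have "(queue_norm (t + 1))\<^sup>2 \<le> (queue_norm (u + 1))\<^sup>2"
        using q_ge2 by (simp add: algebra_simps)
      then have "queue_norm (t + 1) \<le> queue_norm (u + 1)"
        using queue_norm_nonneg by (rule power2_le_imp_le)
      also have "\<dots> \<le> q"
        using less[of u] t by (simp add: q_def)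
      finally show False
        using large by simp
    qed
  qed
qed

lemma norm_search_direction_le:
  "norm (search_direction t) \<le> G * (V + sqrt (real k) * queue_norm (t + 1))"
proof -
  have "norm (search_direction t)
      \<le> norm (V *\<^sub>R f' t (x t)) + norm (\<Sum>i=1..k. Q i (t + 1) *\<^sub>R g' t i (x t))"
    unfolding search_direction_def by (rule norm_triangle_ineq)
  also have "norm (V *\<^sub>R f' t (x t)) \<le> V * G"
    using V_pos bound_f'[OF x_in] by simp
  also have "norm (\<Sum>i=1..k. Q i (t + 1) *\<^sub>R g' t i (x t)) \<le> (\<Sum>i=1..k. Q i (t + 1) * G)"
    by (rule sum_norm_le) (use Q_nonneg bound_g'[OF _ x_in] in \<open>auto intro!: mult_mono\<close>)
  also have "\<dots> = G * (\<Sum>i=1..k. Q i (t + 1))"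
    by (simp add: sum_distrib_left mult.commute)
  also have "\<dots> \<le> G * (sqrt (real k) * queue_norm (t + 1))"
    by (intro mult_left_mono sum_Q_le_queue_norm G_nonneg)
  finally show ?thesis
    by (simp add: algebra_simps)
qed

text \<open>
  A queue is at least the accumulated linearized values, and a linearized value falls below the
  true one at \<open>x t\<close> by at most \<open>G\<close> times the step length.
\<close>
lemma constraint_sum_le_queue:
  assumes i: "i \<in> {1..k}"
  shows "(\<Sum>t<T. g t i (x t)) \<le> Q i (T + 1) + G * (\<Sum>t<T. norm (x (t + 1) - x t))"
proof (induction T)
  case 0
  then show ?case
    using Q_first[OF i] by simp
next
  case (Suc T)
  have "\<bar>g' T i (x T) \<bullet> (x (T + 1) - x T)\<bar> \<le> G * norm (x (T + 1) - x T)"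
    using Cauchy_Schwarz_ineq2 bound_g'[OF i x_in]
    by (meson mult_right_mono norm_ge_zero order_trans)
  moreover have "Q i (T + 1) + (g T i (x T) + g' T i (x T) \<bullet> (x (T + 1) - x T)) \<le> Q i (T + 2)"
    unfolding Q_step[OF i] linearized_def by simp
  ultimately show ?case
    using Suc by (simp add: algebra_simps)
qed

text \<open>
  The queue contributes at most \<open>\<theta> * V\<close>. With \<open>\<alpha> = V\<^sup>2\<close> a step has length at most
  \<open>G * (1 + \<theta> * sqrt k) / (2 * V)\<close>, and \<open>2 * a \<le> 1 + a\<^sup>2\<close> brings the result into the stated form.
\<close>
lemma constraint_violation_bound:
  assumes s: "s \<in> X" and g_s: "\<And>t i. i \<in> {1..k} \<Longrightarrow> g t i s \<le> - \<epsilon>" and "\<epsilon> > 0"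
    and V: "V = real v" and \<alpha>: "\<alpha> = V\<^sup>2" and i: "i \<in> {1..k}" and "T > 0"
  defines "\<theta> \<equiv> \<theta>_const k D F G V \<alpha> \<epsilon>"
  shows "1 / real T * (\<Sum>t<T. g t i (x t))
     \<le> \<theta> * V / real T + G\<^sup>2 / (4 * V) + G\<^sup>2 * (1 + \<theta> * sqrt (real k))\<^sup>2 / (4 * V)"
proof -
  define b where "b = G\<^sup>2 / (4 * V) + G\<^sup>2 * (1 + \<theta> * sqrt (real k))\<^sup>2 / (4 * V)"
  have qb: "queue_norm (t + 1) \<le> \<theta> * V" for t
    unfolding \<theta>_def by (rule queue_norm_bounded[OF s g_s \<open>\<epsilon> > 0\<close> V])
  have step: "G * norm (x (t + 1) - x t) \<le> b" for t
  proof -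
    have "norm (x (t + 1) - x t) \<le> norm (search_direction t) / (2 * \<alpha>)"
      by (intro proximal_step_length[OF convex_X compact_imp_closed[OF compact_X] \<alpha>_pos x_step_min x_in])
    also have "\<dots> \<le> G * (V + sqrt (real k) * (\<theta> * V)) / (2 * \<alpha>)"
    proof (intro divide_right_mono)
      have "G * (V + sqrt (real k) * queue_norm (t + 1)) \<le> G * (V + sqrt (real k) * (\<theta> * V))"
        by (intro mult_left_mono add_left_mono qb G_nonneg) simp
      then show "norm (search_direction t) \<le> G * (V + sqrt (real k) * (\<theta> * V))"
        using norm_search_direction_le[of t] by linarith
    qed (use \<alpha>_pos in simp)
    also have "\<dots> = G * (1 + \<theta> * sqrt (real k)) / (2 * V)"
      using V_pos by (simp add: \<alpha> power2_eq_square field_simps)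
    finally have "G * norm (x (t + 1) - x t) \<le> G * (G * (1 + \<theta> * sqrt (real k)) / (2 * V))"
      by (rule mult_left_mono) (rule G_nonneg)
    also have "\<dots> = G\<^sup>2 / (4 * V) * (2 * (1 + \<theta> * sqrt (real k)))"
      using V_pos by (simp add: power2_eq_square field_simps)
    also have "\<dots> \<le> G\<^sup>2 / (4 * V) * (1 + (1 + \<theta> * sqrt (real k))\<^sup>2)"
      using sum_squares_bound[of 1 "1 + \<theta> * sqrt (real k)"] V_pos
      by (intro mult_left_mono) simp_all
    also have "\<dots> = b"
      unfolding b_def by (simp add: distrib_left)
    finally show ?thesis .
  qed
  have "Q i (T + 1) \<le> queue_norm (T + 1)"
    unfolding queue_norm_def by (rule member_le_L2_set) (use i in auto)
  also note qb
  finally have "(\<Sum>t<T. g t i (x t)) \<le> \<theta> * V + (\<Sum>t<T. G * norm (x (t + 1) - x t))"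
    using constraint_sum_le_queue[OF i, of T] by (simp add: sum_distrib_left)
  also have "(\<Sum>t<T. G * norm (x (t + 1) - x t)) \<le> real T * b"
    using sum_mono[of "{..<T}", OF step] by simp
  finally have "1 / real T * (\<Sum>t<T. g t i (x t)) \<le> 1 / real T * (\<theta> * V + real T * b)"
    by (intro mult_left_mono) simp_all
  also have "\<dots> = \<theta> * V / real T + b"
    using \<open>T > 0\<close> by (simp add: field_simps)
  finally show ?thesis
    by (simp add: b_def add.assoc)
qed

end

section \<open>Measurability and independence\<close>

text \<open>
  A function that is measurable in one argument and continuous in the other may be composed with
  measurable maps in both: replace \<open>u\<close> by the first point of a countable dense subset of \<open>X\<close> that
  is within \<open>1 / (n + 1)\<close> of it, which is a countable case distinction, and let \<open>n\<close> tend to infinity.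
\<close>
lemma borel_measurable_Caratheodory:
  fixes h :: "'a::euclidean_space \<Rightarrow> 'b \<Rightarrow> real"
  assumes meas: "\<And>y. y \<in> X \<Longrightarrow> h y \<in> borel_measurable N"
    and cont: "\<And>w. w \<in> space N \<Longrightarrow> continuous_on X (\<lambda>y. h y w)"
    and u[measurable]: "u \<in> borel_measurable M" and u_in: "\<And>\<xi>. \<xi> \<in> space M \<Longrightarrow> u \<xi> \<in> X"
    and v: "v \<in> measurable M N"
  shows "(\<lambda>\<xi>. h (u \<xi>) (v \<xi>)) \<in> borel_measurable M"
proof (cases "X = {}")
  case True
  then have "space M = {}"
    using u_in by auto
  then show ?thesis
    by (simp add: measurable_def)
next
  case False
  obtain T where T: "countable T" "T \<subseteq> X" "X \<subseteq> closure T"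
    using separable by blast
  then have "T \<noteq> {}"
    using False by auto
  define d where "d = from_nat_into T"
  define J where "J n \<xi> = (LEAST j. dist (d j) (u \<xi>) < inverse (real (Suc n)))" for n \<xi>
  have d_in: "d j \<in> X" for j
    using T(2) from_nat_into[OF \<open>T \<noteq> {}\<close>] by (auto simp: d_def)
  have J_meas: "J n \<in> measurable M (count_space UNIV)" for n
    unfolding J_def by measurable
  have close: "dist (d (J n \<xi>)) (u \<xi>) < inverse (real (Suc n))" if "\<xi> \<in> space M" for n \<xi>
  proof -
    have "u \<xi> \<in> closure T"
      using T(3) u_in[OF that] by auto
    then obtain y where "y \<in> T" "dist y (u \<xi>) < inverse (real (Suc n))"
      by (metis closure_approachable inverse_positive_iff_positive of_nat_0_less_iff zero_less_Suc)
    moreover then obtain j where "y = d j"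
      unfolding d_def by (metis T(1) from_nat_into_surj)
    ultimately have "\<exists>j. dist (d j) (u \<xi>) < inverse (real (Suc n))"
      by blast
    then show ?thesis
      unfolding J_def by (rule LeastI_ex)
  qed
  show ?thesis
  proof (rule borel_measurable_LIMSEQ_real)
    fix \<xi> assume \<xi>: "\<xi> \<in> space M"
    have "(\<lambda>n. dist (d (J n \<xi>)) (u \<xi>)) \<longlonglongrightarrow> 0"
      by (rule tendsto_sandwich[OF _ _ tendsto_const LIMSEQ_inverse_real_of_nat])
        (intro always_eventually allI zero_le_dist less_imp_le[OF close[OF \<xi>]])+
    then have "(\<lambda>n. d (J n \<xi>)) \<longlonglongrightarrow> u \<xi>"
      by (rule iffD2[OF tendsto_dist_iff])
    then show "(\<lambda>n. h (d (J n \<xi>)) (v \<xi>)) \<longlonglongrightarrow> h (u \<xi>) (v \<xi>)"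
      by (rule continuous_on_tendsto_compose[OF cont[OF measurable_space[OF v \<xi>]] _ u_in[OF \<xi>]])
        (simp add: d_in)
  next
    fix n
    show "(\<lambda>\<xi>. h (d (J n \<xi>)) (v \<xi>)) \<in> borel_measurable M"
      by (rule measurable_compose_countable[OF _ J_meas])
        (rule measurable_compose[OF v meas[OF d_in]])
  qed
qed

lemma borel_measurable_closest_point:
  fixes X :: "'a::euclidean_space set"
  assumes "convex X" "closed X" "X \<noteq> {}"
  shows "closest_point X \<in> borel_measurable borel"
  using assms by (intro borel_measurable_continuous_onI continuous_on_closest_point)

text \<open>
  Random variables inherit independence from any two \<open>\<sigma>\<close>-algebras that make them measurable,
  because the \<open>\<sigma>\<close>-algebra generated by a variable is the least such one.
\<close>
lemma (in prob_space) indep_var_of_indep_algebras: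
  fixes Y Z :: "'a \<Rightarrow> 'b"
  assumes indep: "indep_set (sets A) (sets N)"
    and Y: "Y \<in> measurable A S" and Z: "Z \<in> measurable N T"
    and A: "space A = space M" and N: "space N = space M"
  shows "indep_var S Y T Z"
proof -
  have generated: "sigma_sets (space M) {U -` B \<inter> space M |B. B \<in> sets R} \<subseteq> sets L"
    and rv: "sets L \<subseteq> events \<Longrightarrow> random_variable R U"
    if "U \<in> measurable L R" "space L = space M" for U :: "'a \<Rightarrow> 'b" and L R
    using sets.sigma_sets_subset[of "{U -` B \<inter> space M |B. B \<in> sets R}" L]
      measurable_sets[OF that(1)] measurable_space[OF that(1)] that(2)
    by (auto simp: measurable_def)
  have "indep_set (sigma_sets (space M) {Y -` B \<inter> space M |B. B \<in> sets S})
     (sigma_sets (space M) {Z -` B \<inter> space M |B. B \<in> sets T})"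
    using indep generated[OF Y A] generated[OF Z N] unfolding indep_set_def
    by (elim indep_sets_mono_sets) (auto split: bool.splits)
  then show ?thesis
    unfolding indep_var_eq
    using rv[OF Y A indep_setD_ev1[OF indep]] rv[OF Z N indep_setD_ev2[OF indep]] by blast
qed

section \<open>Expected performance of a run\<close>

locale online_run = online_model M X k D F G \<omega> \<eta> fhat ghat fsub gsub
  for M :: "'m measure"
    and X :: "(real ^ 'n) set"
    and k :: nat
    and D F G :: real
    and \<omega> \<eta> :: "nat \<Rightarrow> 'm \<Rightarrow> 'w::euclidean_space"
    and fhat :: "real ^ 'n \<Rightarrow> 'w \<Rightarrow> real"
    and ghat :: "nat \<Rightarrow> real ^ 'n \<Rightarrow> 'w \<Rightarrow> real"
    and fsub :: "nat \<Rightarrow> real ^ 'n \<Rightarrow> 'w \<Rightarrow> real ^ 'n"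
    and gsub :: "nat \<Rightarrow> nat \<Rightarrow> real ^ 'n \<Rightarrow> 'w \<Rightarrow> real ^ 'n" +
  fixes V \<alpha> :: real
    and x0 :: "real ^ 'n"
    and Xs :: "nat \<Rightarrow> 'm \<Rightarrow> real ^ 'n"
    and Q :: "nat \<Rightarrow> nat \<Rightarrow> 'm \<Rightarrow> real"
  assumes V_pos: "V > 0"
    and \<alpha>_pos: "\<alpha> > 0"
    and x0_in: "x0 \<in> X"
    and run: "algorithm_run M X k \<omega> \<eta> fhat ghat fsub gsub V \<alpha> x0 Xs Q"
begin

lemma trajectory:
  assumes "\<xi> \<in> space M"
  shows "algorithm_trajectory X k D F G V \<alpha>
      (\<lambda>t y. fhat y (\<eta> t \<xi>)) (\<lambda>t y. fsub t y (\<eta> t \<xi>))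
      (\<lambda>t i y. ghat i y (\<omega> t \<xi>)) (\<lambda>t i y. gsub t i y (\<omega> t \<xi>))
      x0 (\<lambda>t. Xs t \<xi>) (\<lambda>i t. Q i t \<xi>)"
  by unfold_locales
    (use assms convex_X compact_X D_nonneg F_nonneg G_pos V_pos \<alpha>_pos x0_in diameter bound_f bound_g
      subgradient_f subgradient_g bound_fsub bound_gsub run in \<open>auto simp: algorithm_run_def\<close>)

text \<open>
  The \<open>\<sigma>\<close>-algebra of the noise of the first \<open>t\<close> slots, as a measure space over the sample space so
  that measurability of decisions with respect to it can be stated directly.
\<close>
definition past :: "nat \<Rightarrow> 'm measure" where
  "past t = vimage_algebra (space M) (\<lambda>\<xi>. \<lambda>s\<in>{..<t}. (\<omega> s \<xi>, \<eta> s \<xi>)) (Pi\<^sub>M {..<t} (\<lambda>_. borel))"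

lemma space_past: "space (past t) = space M"
  by (simp add: past_def)

lemma noise_measurable_past:
  assumes "s < t"
  shows "\<omega> s \<in> borel_measurable (past t)" "\<eta> s \<in> borel_measurable (past t)"
proof -
  have "(\<lambda>\<xi>. \<lambda>s\<in>{..<t}. (\<omega> s \<xi>, \<eta> s \<xi>)) \<in> measurable (past t) (Pi\<^sub>M {..<t} (\<lambda>_. borel))"
    unfolding past_def by (rule measurable_vimage_algebra1) (auto simp: space_PiM)
  then have "(\<lambda>\<xi>. (\<lambda>s\<in>{..<t}. (\<omega> s \<xi>, \<eta> s \<xi>)) s) \<in> borel_measurable (past t)"
    by (rule measurable_compose) (use assms in \<open>auto intro: measurable_component_singleton\<close>)
  then have pair: "(\<lambda>\<xi>. (\<omega> s \<xi>, \<eta> s \<xi>)) \<in> borel_measurable (past t)"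
    using assms by simp
  show "\<omega> s \<in> borel_measurable (past t)"
    using measurable_compose[OF pair borel_measurable_continuous_onI[OF continuous_on_fst[OF continuous_on_id]]] by simp
  show "\<eta> s \<in> borel_measurable (past t)"
    using measurable_compose[OF pair borel_measurable_continuous_onI[OF continuous_on_snd[OF continuous_on_id]]] by simp
qed

text \<open>
  Leastness of \<open>past t\<close>, phrased as measurability of the identity; monotonicity in \<open>t\<close> and
  inclusion in \<open>M\<close> are both instances.
\<close>
lemma past_least:
  assumes "space N = space M"
    and "\<And>s. s < t \<Longrightarrow> \<omega> s \<in> borel_measurable N" "\<And>s. s < t \<Longrightarrow> \<eta> s \<in> borel_measurable N"
  shows "(\<lambda>\<xi>. \<xi>) \<in> measurable N (past t)"
  unfolding past_def
proof (rule measurable_vimage_algebra2)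
  show "(\<lambda>\<xi>. \<lambda>s\<in>{..<t}. (\<omega> s \<xi>, \<eta> s \<xi>)) \<in> measurable N (Pi\<^sub>M {..<t} (\<lambda>_. borel))"
    by (rule measurable_restrict) (use assms in \<open>auto intro: borel_measurable_Pair\<close>)
qed (use assms(1) in simp)

lemma measurable_past_mono:
  assumes "h \<in> measurable (past s) N" "s \<le> t"
  shows "h \<in> measurable (past t) N"
  using measurable_compose[OF past_least[of "past t" s] assms(1)] assms(2) noise_measurable_past
  by (simp add: space_past)

lemma past_subalgebra:
  assumes "h \<in> measurable (past t) N"
  shows "h \<in> measurable M N"
  using measurable_compose[OF past_least[of M t] assms] rv_\<omega> rv_\<eta> by simp

lemma integrable_at_fixed_decision:
  assumes "y \<in> X"
  shows "integrable M (\<lambda>\<xi>. fhat y (\<eta> t \<xi>))"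
    and "i \<in> {1..k} \<Longrightarrow> integrable M (\<lambda>\<xi>. ghat i y (\<omega> t \<xi>))"
proof -
  show "integrable M (\<lambda>\<xi>. fhat y (\<eta> t \<xi>))"
    by (rule integrable_const_bound[of _ F])
      (use bound_f assms measurable_compose[OF rv_\<eta> measurable_f] in auto)
  show "integrable M (\<lambda>\<xi>. ghat i y (\<omega> t \<xi>))" if "i \<in> {1..k}"
    by (rule integrable_const_bound[of _ F])
      (use that bound_g assms measurable_compose[OF rv_\<omega> measurable_g] in auto)
qed

context
  assumes causal: "causal_information M X k \<omega> \<eta> fsub gsub"
begin

text \<open>
  The decision of slot \<open>t\<close> and the queues of slot \<open>t + 1\<close> both depend on the noise of slots
  before \<open>t\<close> only. The index of the queue runs ahead by one since the update that produces
  \<open>Q i (t + 1)\<close> uses the constraint functions of slot \<open>t - 1\<close>.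
\<close>
lemma decisions_queues_measurable_past:
  "Xs t \<in> borel_measurable (past t) \<and> (\<forall>i\<in>{1..k}. Q i (t + 1) \<in> borel_measurable (past t))"
proof (induction t)
  case 0
  have "Xs 0 \<in> borel_measurable (past 0) \<longleftrightarrow> (\<lambda>_. x0) \<in> borel_measurable (past 0)"
    by (rule measurable_cong) (use run in \<open>auto simp: space_past algorithm_run_def algorithm_path_def\<close>)
  moreover have "Q i (0 + 1) \<in> borel_measurable (past 0) \<longleftrightarrow> (\<lambda>_. 0::real) \<in> borel_measurable (past 0)"
    if "i \<in> {1..k}" for i
    by (rule measurable_cong)
      (use run that in \<open>auto simp: space_past algorithm_run_def algorithm_path_def\<close>)
  ultimately show ?case by auto
next
  case (Suc t)
  let ?N = "past (t + 1)"
  let ?grad = "\<lambda>i \<xi>. gsub t i (Xs t \<xi>) (\<omega> t \<xi>)"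
  let ?dir = "\<lambda>\<xi>. V *\<^sub>R fsub t (Xs t \<xi>) (\<eta> t \<xi>) + (\<Sum>i=1..k. Q i (t + 1) \<xi> *\<^sub>R ?grad i \<xi>)"
  have X_in: "Xs t \<xi> \<in> X" if "\<xi> \<in> space ?N" for \<xi>
    using algorithm_trajectory.x_in[OF trajectory] that by (simp add: space_past)
  have X_meas: "Xs t \<in> borel_measurable ?N"
    by (rule measurable_past_mono[OF conjunct1[OF Suc]]) simp
  have Q_meas: "Q i (t + 1) \<in> borel_measurable ?N" if "i \<in> {1..k}" for i
    by (rule measurable_past_mono[OF bspec[OF conjunct2[OF Suc] that]]) simp
  have \<omega>_meas: "\<omega> t \<in> borel_measurable ?N" and \<eta>_meas: "\<eta> t \<in> borel_measurable ?N"
    by (intro noise_measurable_past; simp)+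
  have X_restrict: "Xs t \<in> measurable ?N (restrict_space borel X)"
    by (rule measurable_restrict_space2) (use X_in X_meas in auto)
  have f_grad_meas: "(\<lambda>\<xi>. fsub t (Xs t \<xi>) (\<eta> t \<xi>)) \<in> borel_measurable ?N"
  proof -
    have "(\<lambda>(y, e). fsub t y e) \<in> borel_measurable (restrict_space borel X \<Otimes>\<^sub>M borel)"
      using causal by (simp add: causal_information_def)
    from measurable_compose[OF measurable_Pair[OF X_restrict \<eta>_meas] this] show ?thesis
      by (simp only: prod.case)
  qed
  have grad_meas: "?grad i \<in> borel_measurable ?N" if "i \<in> {1..k}" for i
  proof -
    have "(\<lambda>(y, w). gsub t i y w) \<in> borel_measurable (restrict_space borel X \<Otimes>\<^sub>M borel)"
      using causal that by (simp add: causal_information_def)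
    from measurable_compose[OF measurable_Pair[OF X_restrict \<omega>_meas] this] show ?thesis
      by (simp only: prod.case)
  qed
  have g_meas: "(\<lambda>\<xi>. ghat i (Xs t \<xi>) (\<omega> t \<xi>)) \<in> borel_measurable ?N" if "i \<in> {1..k}" for i
    by (rule borel_measurable_Caratheodory[where X = X and h = "ghat i", OF measurable_g[OF that]
          continuous_g[OF that] X_meas X_in \<omega>_meas])
  have proj_meas: "closest_point X \<in> borel_measurable borel"
    using convex_X compact_imp_closed[OF compact_X] x0_in by (intro borel_measurable_closest_point) auto
  have dir: "?dir \<in> borel_measurable ?N"
    by (intro borel_measurable_add borel_measurable_scaleR borel_measurable_const borel_measurable_sum
        Q_meas grad_meas f_grad_meas)
  have "Xs (t + 1) \<in> borel_measurable ?N
      \<longleftrightarrow> (\<lambda>\<xi>. closest_point X (Xs t \<xi> - (1 / (2 * \<alpha>)) *\<^sub>R ?dir \<xi>)) \<in> borel_measurable ?N"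
    by (rule measurable_cong)
      (simp only: space_past algorithm_trajectory.x_step_eq[OF trajectory]
        algorithm_trajectory.search_direction_def[OF trajectory])
  moreover have "(\<lambda>\<xi>. closest_point X (Xs t \<xi> - (1 / (2 * \<alpha>)) *\<^sub>R ?dir \<xi>)) \<in> borel_measurable ?N"
    by (intro measurable_compose[OF _ proj_meas] borel_measurable_diff borel_measurable_scaleR
        borel_measurable_const X_meas dir)
  ultimately have X_next: "Xs (t + 1) \<in> borel_measurable ?N"
    by simp
  have Q_next: "Q i (t + 2) \<in> borel_measurable ?N" if i: "i \<in> {1..k}" for i
  proof -
    have "Q i (t + 2) \<in> borel_measurable ?N
      \<longleftrightarrow> (\<lambda>\<xi>. max (Q i (t + 1) \<xi> + (ghat i (Xs t \<xi>) (\<omega> t \<xi>)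
              + ?grad i \<xi> \<bullet> (Xs (t + 1) \<xi> - Xs t \<xi>))) 0) \<in> borel_measurable ?N"
      by (rule measurable_cong)
        (simp only: space_past algorithm_trajectory.Q_step[OF trajectory i]
          algorithm_trajectory.linearized_def[OF trajectory])
    moreover have "(\<lambda>\<xi>. max (Q i (t + 1) \<xi> + (ghat i (Xs t \<xi>) (\<omega> t \<xi>)
              + ?grad i \<xi> \<bullet> (Xs (t + 1) \<xi> - Xs t \<xi>))) 0) \<in> borel_measurable ?N"
      by (intro borel_measurable_max borel_measurable_add borel_measurable_inner borel_measurable_diff
          borel_measurable_const Q_meas[OF i] g_meas[OF i] grad_meas[OF i] X_meas X_next)
    ultimately show ?thesis by simp
  qed
  have "Suc t = t + 1" "Suc t + 1 = t + 2"
    by simp_all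
  with X_next Q_next show ?case
    by (simp only:) blast
qed

lemma integrable_queue_term:
  assumes "i \<in> {1..k}" "y \<in> X"
  shows "integrable M (\<lambda>\<xi>. Q i (t + 1) \<xi> * ghat i y (\<omega> s \<xi>))"
proof (rule integrable_const_bound[of _ "real t * (F + G * D) * F"])
  have "Q i (t + 1) \<in> borel_measurable M"
    using decisions_queues_measurable_past assms(1) past_subalgebra by blast
  moreover have "(\<lambda>\<xi>. ghat i y (\<omega> s \<xi>)) \<in> borel_measurable M"
    using measurable_compose[OF rv_\<omega> measurable_g] assms by simp
  ultimately show "(\<lambda>\<xi>. Q i (t + 1) \<xi> * ghat i y (\<omega> s \<xi>)) \<in> borel_measurable M"
    by (rule borel_measurable_times)
  show "AE \<xi> in M. norm (Q i (t + 1) \<xi> * ghat i y (\<omega> s \<xi>)) \<le> real t * (F + G * D) * F"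
  proof (rule AE_I2)
    fix \<xi> assume \<xi>: "\<xi> \<in> space M"
    interpret algorithm_trajectory X k D F G V \<alpha>
      "\<lambda>t y. fhat y (\<eta> t \<xi>)" "\<lambda>t y. fsub t y (\<eta> t \<xi>)"
      "\<lambda>t i y. ghat i y (\<omega> t \<xi>)" "\<lambda>t i y. gsub t i y (\<omega> t \<xi>)"
      x0 "\<lambda>t. Xs t \<xi>" "\<lambda>i t. Q i t \<xi>"
      by (rule trajectory[OF \<xi>])
    show "norm (Q i (t + 1) \<xi> * ghat i y (\<omega> s \<xi>)) \<le> real t * (F + G * D) * F"
      unfolding real_norm_def abs_mult using Q_le_linear[OF assms(1), of t] Q_nonneg[OF assms(1), of t]
      by (intro mult_mono bound_g assms) auto
  qed
qed

text \<open>
  The queue \<open>Q i (t + 1)\<close> may involve \<open>\<eta> (t - 1)\<close>, which may depend on \<open>\<omega> t\<close>. But \<open>Q i t\<close> depends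
  only on the noise before slot \<open>t - 1\<close>, which is independent of \<open>\<omega> t\<close>, so the expected product
  with \<open>Q i t\<close> factors into a nonnegative and a nonpositive expectation. Exchanging \<open>Q i (t + 1)\<close> for \<open>Q i t\<close> changes
  the product by at most \<open>F\<close> times the largest queue increment \<open>F + D * G\<close>.
\<close>
lemma expected_queue_term_le:
  assumes i: "i \<in> {1..k}" and y: "y \<in> feasible_set M X k \<omega> ghat"
  shows "(LINT \<xi>|M. Q i (t + 1) \<xi> * ghat i y (\<omega> t \<xi>)) \<le> F * (F + D * G)"
proof (cases t)
  case 0
  have "(LINT \<xi>|M. Q i (t + 1) \<xi> * ghat i y (\<omega> t \<xi>)) = (LINT \<xi>|M. 0)"
    using 0 algorithm_trajectory.Q_first[OF trajectory i] by (intro Bochner_Integration.integral_cong) simp_all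
  then show ?thesis
    using F_nonneg D_nonneg G_pos by simp
next
  case (Suc s)
  have yX: "y \<in> X" and y_neg: "(LINT \<xi>|M. ghat i y (\<omega> t \<xi>)) \<le> 0"
    using y i by (auto simp: feasible_set_def)
  have Q_meas: "Q i (s + 1) \<in> borel_measurable (past s)"
    using decisions_queues_measurable_past i by blast
  let ?A = "vimage_algebra (space M) (\<omega> t) borel"
  have "indep_set (sets ?A) (sets (past s))"
    using causal Suc by (simp add: causal_information_def past_def)
  moreover have "(\<lambda>\<xi>. ghat i y (\<omega> t \<xi>)) \<in> borel_measurable ?A"
    by (rule measurable_compose[OF measurable_vimage_algebra1 measurable_g[OF i yX]]) simp
  ultimately have indep: "indep_var borel (\<lambda>\<xi>. ghat i y (\<omega> t \<xi>)) borel (Q i (s + 1))"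
    by (rule indep_var_of_indep_algebras[OF _ _ Q_meas _ space_past]) simp
  have Q_int: "integrable M (Q i (s + 1))"
    by (rule integrable_const_bound[of _ "real s * (F + G * D)"])
      (use algorithm_trajectory.Q_le_linear[OF trajectory i, of _ s]
        algorithm_trajectory.Q_nonneg[OF trajectory i, of _ s] past_subalgebra[OF Q_meas] in auto)
  have "(LINT \<xi>|M. ghat i y (\<omega> t \<xi>) * Q i (s + 1) \<xi>)
      = (LINT \<xi>|M. ghat i y (\<omega> t \<xi>)) * (LINT \<xi>|M. Q i (s + 1) \<xi>)"
    by (rule indep_var_lebesgue_integral[OF indep integrable_at_fixed_decision(2)[OF yX i] Q_int])
  also have "\<dots> \<le> 0"
    using y_neg algorithm_trajectory.Q_nonneg[OF trajectory i, of _ s]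
    by (intro mult_nonpos_nonneg Bochner_Integration.integral_nonneg) auto
  finally have decoupled: "(LINT \<xi>|M. Q i (s + 1) \<xi> * ghat i y (\<omega> t \<xi>)) \<le> 0"
    by (simp add: mult.commute)
  have "Q i (t + 1) \<xi> * ghat i y (\<omega> t \<xi>) \<le> Q i (s + 1) \<xi> * ghat i y (\<omega> t \<xi>) + F * (F + D * G)"
    if \<xi>: "\<xi> \<in> space M" for \<xi>
  proof -
    have "\<bar>(Q i (t + 1) \<xi> - Q i (s + 1) \<xi>) * ghat i y (\<omega> t \<xi>)\<bar> \<le> (F + G * D) * F"
      unfolding abs_mult
      using algorithm_trajectory.abs_Q_diff_le[OF trajectory[OF \<xi>] i, of s] Suc D_nonneg F_nonneg G_pos
      by (intro mult_mono bound_g[OF i yX \<xi>]) auto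
    then show ?thesis
      by (simp add: algebra_simps)
  qed
  then have "(LINT \<xi>|M. Q i (t + 1) \<xi> * ghat i y (\<omega> t \<xi>))
      \<le> (LINT \<xi>|M. Q i (s + 1) \<xi> * ghat i y (\<omega> t \<xi>) + F * (F + D * G))"
    by (intro integral_mono integrable_queue_term Bochner_Integration.integrable_add i yX) auto
  also have "\<dots> = (LINT \<xi>|M. Q i (s + 1) \<xi> * ghat i y (\<omega> t \<xi>)) + F * (F + D * G)"
    by (simp add: integrable_queue_term[OF i yX, simplified] prob_space)
  finally show ?thesis
    using decoupled by simp
qed

lemma expected_regret_bound:
  assumes y: "y \<in> feasible_set M X k \<omega> ghat"
  shows "V * (\<Sum>t<T. LINT \<xi>|M. fhat (Xs t \<xi>) (\<eta> t \<xi>))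
     \<le> V * (\<Sum>t<T. LINT \<xi>|M. fhat y (\<eta> t \<xi>))
       + real T * (C_const k D F G + V\<^sup>2 * G\<^sup>2 / (4 * \<alpha>)) + \<alpha> * D\<^sup>2"
proof -
  have yX: "y \<in> X"
    using y by (simp add: feasible_set_def)
  define K where "K = real T * (B_const k D F G + V\<^sup>2 * G\<^sup>2 / (4 * \<alpha>)) + \<alpha> * D\<^sup>2"
  have f_int: "integrable M (\<lambda>\<xi>. fhat (Xs t \<xi>) (\<eta> t \<xi>))" for t
    using run by (simp add: algorithm_run_def)
  note int = f_int integrable_at_fixed_decision(1)[OF yX] integrable_queue_term[OF _ yX]
  have inner_int: "integrable M (\<lambda>\<xi>. \<Sum>i=1..k. Q i (t + 1) \<xi> * ghat i y (\<omega> t \<xi>))" for t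
    by (intro Bochner_Integration.integrable_sum int)
  have queue_int: "integrable M (\<lambda>\<xi>. \<Sum>t<T. \<Sum>i=1..k. Q i (t + 1) \<xi> * ghat i y (\<omega> t \<xi>))"
    by (intro Bochner_Integration.integrable_sum inner_int)
  have "(LINT \<xi>|M. (\<Sum>t<T. \<Sum>i=1..k. Q i (t + 1) \<xi> * ghat i y (\<omega> t \<xi>)))
      = (\<Sum>t<T. LINT \<xi>|M. (\<Sum>i=1..k. Q i (t + 1) \<xi> * ghat i y (\<omega> t \<xi>)))"
    by (rule Bochner_Integration.integral_sum) (rule inner_int)
  also have "\<dots> = (\<Sum>t<T. \<Sum>i=1..k. LINT \<xi>|M. Q i (t + 1) \<xi> * ghat i y (\<omega> t \<xi>))"
    by (intro sum.cong refl Bochner_Integration.integral_sum int)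
  finally have queue_eq: "(LINT \<xi>|M. (\<Sum>t<T. \<Sum>i=1..k. Q i (t + 1) \<xi> * ghat i y (\<omega> t \<xi>)))
      = (\<Sum>t<T. \<Sum>i=1..k. LINT \<xi>|M. Q i (t + 1) \<xi> * ghat i y (\<omega> t \<xi>))" .
  have "V * (\<Sum>t<T. LINT \<xi>|M. fhat (Xs t \<xi>) (\<eta> t \<xi>))
      = (LINT \<xi>|M. V * (\<Sum>t<T. fhat (Xs t \<xi>) (\<eta> t \<xi>)))"
    by (simp add: int)
  also have "\<dots> \<le> (LINT \<xi>|M. V * (\<Sum>t<T. fhat y (\<eta> t \<xi>))
      + (\<Sum>t<T. \<Sum>i=1..k. Q i (t + 1) \<xi> * ghat i y (\<omega> t \<xi>)) + K)"
  proof (rule integral_mono)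
    show "V * (\<Sum>t<T. fhat (Xs t \<xi>) (\<eta> t \<xi>)) \<le> V * (\<Sum>t<T. fhat y (\<eta> t \<xi>))
      + (\<Sum>t<T. \<Sum>i=1..k. Q i (t + 1) \<xi> * ghat i y (\<omega> t \<xi>)) + K" if "\<xi> \<in> space M" for \<xi>
      using algorithm_trajectory.regret_with_queue_terms[OF trajectory[OF that] yX, of T]
      by (simp add: K_def)
  qed (intro Bochner_Integration.integrable_add Bochner_Integration.integrable_sum
      integrable_mult_right int integrable_const; assumption)+
  also have "\<dots> = V * (\<Sum>t<T. LINT \<xi>|M. fhat y (\<eta> t \<xi>))
      + (\<Sum>t<T. \<Sum>i=1..k. LINT \<xi>|M. Q i (t + 1) \<xi> * ghat i y (\<omega> t \<xi>)) + K"
    unfolding queue_eq[symmetric]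
    using int(2) queue_int by (simp add: prob_space)
  also have "(\<Sum>t<T. \<Sum>i=1..k. LINT \<xi>|M. Q i (t + 1) \<xi> * ghat i y (\<omega> t \<xi>))
      \<le> (\<Sum>t<T. \<Sum>i=1..k. F * (F + D * G))"
    by (intro sum_mono expected_queue_term_le y)
  finally show ?thesis
    by (simp add: K_def C_const_def algebra_simps)
qed

end

text \<open>
  With \<open>\<alpha> = V\<^sup>2\<close> the first-order error \<open>V\<^sup>2 * G\<^sup>2 / (4 * \<alpha>)\<close> is the constant \<open>G\<^sup>2 / 4\<close>; dividing the
  expected regret by \<open>V * T\<close> gives the claim.
\<close>
lemma time_average_regret:
  assumes causal: "causal_information M X k \<omega> \<eta> fsub gsub" and \<alpha>: "\<alpha> = V\<^sup>2"
    and y: "y \<in> feasible_set M X k \<omega> ghat" and "T > 0"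
  shows "1 / real T * (\<Sum>t<T. LINT \<xi>|M. fhat (Xs t \<xi>) (\<eta> t \<xi>))
     \<le> 1 / real T * (\<Sum>t<T. LINT \<xi>|M. fhat y (\<eta> t \<xi>))
       + C_const k D F G / V + G\<^sup>2 / (2 * V) + V * D\<^sup>2 / real T"
proof -
  define a where "a = (\<Sum>t<T. LINT \<xi>|M. fhat (Xs t \<xi>) (\<eta> t \<xi>))"
  define b where "b = (\<Sum>t<T. LINT \<xi>|M. fhat y (\<eta> t \<xi>))"
  have "V * a \<le> V * b + real T * (C_const k D F G + G\<^sup>2 / 4) + V\<^sup>2 * D\<^sup>2"
    using expected_regret_bound[OF causal y, of T] V_pos by (simp add: \<alpha> a_def b_def)
  then have "V * a / (V * real T)
      \<le> (V * b + real T * (C_const k D F G + G\<^sup>2 / 4) + V\<^sup>2 * D\<^sup>2) / (V * real T)"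
    using V_pos by (intro divide_right_mono) simp_all
  also have "\<dots> = b / real T + C_const k D F G / V + G\<^sup>2 / (4 * V) + V * D\<^sup>2 / real T"
    using V_pos \<open>T > 0\<close> by (simp add: power2_eq_square field_simps)
  also have "G\<^sup>2 / (4 * V) \<le> G\<^sup>2 / (2 * V)"
    using V_pos by (intro divide_left_mono) simp_all
  finally show ?thesis
    using V_pos by (simp add: a_def b_def)
qed

lemma time_average_regret_long:
  assumes causal: "causal_information M X k \<omega> \<eta> fsub gsub" and \<alpha>: "\<alpha> = V\<^sup>2"
    and y: "y \<in> feasible_set M X k \<omega> ghat" and T: "real T \<ge> V\<^sup>2"
  shows "1 / real T * (\<Sum>t<T. LINT \<xi>|M. fhat (Xs t \<xi>) (\<eta> t \<xi>))
     \<le> 1 / real T * (\<Sum>t<T. LINT \<xi>|M. fhat y (\<eta> t \<xi>))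
       + (C_const k D F G + G\<^sup>2 / 2 + D\<^sup>2) / V"
proof -
  have "0 < V\<^sup>2" using V_pos by simp
  then have T_pos: "T > 0" using T by (cases T) auto
  have "V * D\<^sup>2 / real T \<le> V * D\<^sup>2 / V\<^sup>2"
    using V_pos T T_pos by (intro divide_left_mono) auto
  also have "\<dots> = D\<^sup>2 / V"
    using V_pos by (simp add: power2_eq_square)
  finally show ?thesis
    using time_average_regret[OF causal \<alpha> y T_pos] by (simp add: add_divide_distrib)
qed

lemma time_average_constraint:
  assumes slater: "slater M X k \<omega> ghat \<epsilon> s" and V: "V = real v" and \<alpha>: "\<alpha> = V\<^sup>2"
    and i: "i \<in> {1..k}" and "T > 0" and \<xi>: "\<xi> \<in> space M"
  defines "\<theta> \<equiv> \<theta>_const k D F G V \<alpha> \<epsilon>"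
  shows "1 / real T * (\<Sum>t<T. ghat i (Xs t \<xi>) (\<omega> t \<xi>))
     \<le> \<theta> * V / real T + G\<^sup>2 / (4 * V) + G\<^sup>2 * (1 + \<theta> * sqrt (real k))\<^sup>2 / (4 * V)"
  unfolding \<theta>_def
  by (rule algorithm_trajectory.constraint_violation_bound[OF trajectory[OF \<xi>]])
    (use slater V \<alpha> i \<open>T > 0\<close> \<xi> in \<open>auto simp: slater_def\<close>)

lemma expected_average_le:
  assumes i: "i \<in> {1..k}"
    and le: "\<And>\<xi>. \<xi> \<in> space M \<Longrightarrow> a * (\<Sum>t<T. ghat i (Xs t \<xi>) (\<omega> t \<xi>)) \<le> b"
  shows "a * (\<Sum>t<T. LINT \<xi>|M. ghat i (Xs t \<xi>) (\<omega> t \<xi>)) \<le> b"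
proof -
  have int: "integrable M (\<lambda>\<xi>. ghat i (Xs t \<xi>) (\<omega> t \<xi>))" for t
    using run i by (simp add: algorithm_run_def)
  have "a * (\<Sum>t<T. LINT \<xi>|M. ghat i (Xs t \<xi>) (\<omega> t \<xi>))
      = (LINT \<xi>|M. a * (\<Sum>t<T. ghat i (Xs t \<xi>) (\<omega> t \<xi>)))"
    by (simp add: int)
  also have "\<dots> \<le> b"
    by (rule integral_le_const) (use int le in auto)
  finally show ?thesis .
qed

end

section \<open>Constants that are uniform in the step parameter\<close>

text \<open>
  A bound for \<open>\<theta>_const\<close> with \<open>\<alpha> = V\<^sup>2\<close> over all \<open>V \<ge> 1\<close>: every summand of \<open>\<theta>_const\<close> is replaced
  by its largest value in that range or an upper bound of it, and the maximum is bounded by the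
  second alternative so enlarged.
\<close>
definition \<theta>_uniform :: "nat \<Rightarrow> real \<Rightarrow> real \<Rightarrow> real \<Rightarrow> real \<Rightarrow> real" where
  "\<theta>_uniform k D F G \<epsilon> =
     3 / 2 * \<delta>_const k D F G + (B_const k D F G + G\<^sup>2 / 2 + 2 * F + D\<^sup>2) / \<epsilon>"

definition violation_const :: "nat \<Rightarrow> real \<Rightarrow> real \<Rightarrow> real \<Rightarrow> real \<Rightarrow> real" where
  "violation_const k D F G \<epsilon> = \<theta>_uniform k D F G \<epsilon>
     + G\<^sup>2 / 4 + G\<^sup>2 * (1 + \<theta>_uniform k D F G \<epsilon> * sqrt (real k))\<^sup>2 / 4"

lemma \<theta>_const_le_uniform:
  assumes "1 \<le> V" "\<epsilon> > 0" "D \<ge> 0" "F \<ge> 0" "G \<ge> 0"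
  shows "\<theta>_const k D F G V (V\<^sup>2) \<epsilon> \<le> \<theta>_uniform k D F G \<epsilon>"
proof -
  let ?B = "B_const k D F G" and ?\<delta> = "\<delta>_const k D F G"
  have pos: "0 \<le> ?\<delta>" "0 \<le> ?B"
    using assms by (simp_all add: \<delta>_const_def B_const_def)
  have "(?B + R_const F G V (V\<^sup>2) * V) / (\<epsilon> * V) = (?B / V + G\<^sup>2 / (2 * V) + 2 * F) / \<epsilon>"
    using assms by (simp add: R_const_def power2_eq_square field_simps)
  also have "\<dots> \<le> (?B + G\<^sup>2 / 2 + 2 * F) / \<epsilon>"
  proof -
    have "?B / V \<le> ?B / 1" "G\<^sup>2 / (2 * V) \<le> G\<^sup>2 / 2"
      using assms pos by (intro divide_left_mono; simp)+
    then show ?thesis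
      using assms by (intro divide_right_mono) auto
  qed
  finally have 1: "(?B + R_const F G V (V\<^sup>2) * V) / (\<epsilon> * V) \<le> (?B + G\<^sup>2 / 2 + 2 * F) / \<epsilon>" .
  have "V\<^sup>2 * D\<^sup>2 / (\<epsilon> * V * (V + 1)) = (V / (V + 1)) * (D\<^sup>2 / \<epsilon>)"
    using assms by (simp add: power2_eq_square)
  also have "\<dots> \<le> 1 * (D\<^sup>2 / \<epsilon>)"
    using assms by (intro mult_right_mono) auto
  finally have 2: "V\<^sup>2 * D\<^sup>2 / (\<epsilon> * V * (V + 1)) \<le> D\<^sup>2 / \<epsilon>" by simp
  have "?\<delta> * (V + 2) / (2 * V) \<le> ?\<delta> * (3 * V) / (2 * V)"
    using assms pos by (intro divide_right_mono mult_left_mono) auto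
  then have 3: "?\<delta> * (V + 2) / (2 * V) \<le> 3 / 2 * ?\<delta>"
    using assms by simp
  have "0 \<le> (?B + G\<^sup>2 / 2 + 2 * F + D\<^sup>2) / \<epsilon>"
    using assms pos by simp
  then have "?\<delta> \<le> \<theta>_uniform k D F G \<epsilon>"
    unfolding \<theta>_uniform_def using pos by linarith
  moreover have "(?B + G\<^sup>2 / 2 + 2 * F + D\<^sup>2) / \<epsilon> = (?B + G\<^sup>2 / 2 + 2 * F) / \<epsilon> + D\<^sup>2 / \<epsilon>"
    by (simp only: add_divide_distrib)
  ultimately show ?thesis
    unfolding \<theta>_const_def using 1 2 3
    by (intro max.boundedI) (unfold \<theta>_uniform_def, linarith+)
qed

lemma constraint_bound_le_violation_const:
  fixes k :: nat
  assumes "1 \<le> V" "\<epsilon> > 0" "D \<ge> 0" "F \<ge> 0" "G \<ge> 0" and T: "V\<^sup>2 \<le> T"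
  defines "\<theta> \<equiv> \<theta>_const k D F G V (V\<^sup>2) \<epsilon>"
  shows "\<theta> * V / T + G\<^sup>2 / (4 * V) + G\<^sup>2 * (1 + \<theta> * sqrt (real k))\<^sup>2 / (4 * V)
     \<le> violation_const k D F G \<epsilon> / V"
proof -
  define \<Theta> where "\<Theta> = \<theta>_uniform k D F G \<epsilon>"
  have le: "\<theta> \<le> \<Theta>"
    unfolding \<theta>_def \<Theta>_def by (rule \<theta>_const_le_uniform[OF assms(1-5)])
  have "0 \<le> \<delta>_const k D F G"
    using assms by (simp add: \<delta>_const_def)
  then have nonneg: "0 \<le> \<theta>"
    unfolding \<theta>_def \<theta>_const_def by simp
  have "\<theta> * V / T \<le> \<Theta> * V / V\<^sup>2"
    using le nonneg assms(1) T by (intro frac_le mult_right_mono mult_nonneg_nonneg) auto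
  also have "\<dots> = \<Theta> / V"
    using assms(1) by (simp add: power2_eq_square)
  finally have 1: "\<theta> * V / T \<le> \<Theta> / V" .
  have "G\<^sup>2 * (1 + \<theta> * sqrt (real k))\<^sup>2 / (4 * V) \<le> G\<^sup>2 * (1 + \<Theta> * sqrt (real k))\<^sup>2 / (4 * V)"
    using le nonneg assms(1)
    by (intro divide_right_mono mult_left_mono power_mono add_left_mono mult_right_mono) auto
  with 1 show ?thesis
    by (simp add: violation_const_def flip: \<Theta>_def) (simp add: add_divide_distrib)
qed

section \<open>Time averages of objective and constraints\<close>

theorem theorem4:
  fixes M :: "'m measure"
    and X :: "(real ^ 'n) set"
    and k :: nat
    and D F G :: real
    and \<omega> \<eta> :: "nat \<Rightarrow> 'm \<Rightarrow> 'w::euclidean_space"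
    and fhat :: "real ^ 'n \<Rightarrow> 'w \<Rightarrow> real"
    and ghat :: "nat \<Rightarrow> real ^ 'n \<Rightarrow> 'w \<Rightarrow> real"
    and fsub :: "nat \<Rightarrow> real ^ 'n \<Rightarrow> 'w \<Rightarrow> real ^ 'n"
    and gsub :: "nat \<Rightarrow> nat \<Rightarrow> real ^ 'n \<Rightarrow> 'w \<Rightarrow> real ^ 'n"
    and x0 :: "real ^ 'n"
  assumes model: "online_model M X k D F G \<omega> \<eta> fhat ghat fsub gsub"
    and x0: "x0 \<in> X"
    and feasible: "feasible_set M X k \<omega> ghat \<noteq> {}"
  shows
    "(causal_information M X k \<omega> \<eta> fsub gsub \<longrightarrow>
        (\<forall>V::nat. V > 0 \<longrightarrow> (\<forall>Xs Q.
           algorithm_run M X k \<omega> \<eta> fhat ghat fsub gsub (real V) ((real V)\<^sup>2) x0 Xs Q \<longrightarrow>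
           (\<forall>x\<in>feasible_set M X k \<omega> ghat. \<forall>T::nat. T > 0 \<longrightarrow>
              (1 / real T) * (\<Sum>t<T. LINT \<xi>|M. fhat (Xs t \<xi>) (\<eta> t \<xi>))
              \<le> (1 / real T) * (\<Sum>t<T. LINT \<xi>|M. fhat x (\<eta> t \<xi>))
                 + C_const k D F G / real V + G\<^sup>2 / (2 * real V) + real V * D\<^sup>2 / real T)))
        \<and>
        (\<exists>c::real. \<forall>V::nat. V > 0 \<longrightarrow> (\<forall>Xs Q.
           algorithm_run M X k \<omega> \<eta> fhat ghat fsub gsub (real V) ((real V)\<^sup>2) x0 Xs Q \<longrightarrow>
           (\<forall>x\<in>feasible_set M X k \<omega> ghat. \<forall>T::nat. T \<ge> V\<^sup>2 \<longrightarrow>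
              (1 / real T) * (\<Sum>t<T. LINT \<xi>|M. fhat (Xs t \<xi>) (\<eta> t \<xi>))
              \<le> (1 / real T) * (\<Sum>t<T. LINT \<xi>|M. fhat x (\<eta> t \<xi>)) + c / real V))))
     \<and>
     (\<forall>\<epsilon> s. slater M X k \<omega> ghat \<epsilon> s \<longrightarrow>
        (\<forall>V::nat. V > 0 \<longrightarrow> (\<forall>Xs Q.
           algorithm_run M X k \<omega> \<eta> fhat ghat fsub gsub (real V) ((real V)\<^sup>2) x0 Xs Q \<longrightarrow>
           (\<forall>T::nat. T > 0 \<longrightarrow> (\<forall>i\<in>{1..k}.
              (let \<theta> = \<theta>_const k D F G (real V) ((real V)\<^sup>2) \<epsilon>;
                   b = \<theta> * real V / real T + G\<^sup>2 / (4 * real V)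
                       + G\<^sup>2 * (1 + \<theta> * sqrt (real k))\<^sup>2 / (4 * real V)
               in (\<forall>\<xi>\<in>space M. (1 / real T) * (\<Sum>t<T. ghat i (Xs t \<xi>) (\<omega> t \<xi>)) \<le> b) \<and>
                  (1 / real T) * (\<Sum>t<T. LINT \<xi>|M. ghat i (Xs t \<xi>) (\<omega> t \<xi>)) \<le> b)))))
        \<and>
        (\<exists>c::real. \<forall>V::nat. V > 0 \<longrightarrow> (\<forall>Xs Q.
           algorithm_run M X k \<omega> \<eta> fhat ghat fsub gsub (real V) ((real V)\<^sup>2) x0 Xs Q \<longrightarrow>
           (\<forall>T::nat. T \<ge> V\<^sup>2 \<longrightarrow> (\<forall>i\<in>{1..k}.
              (\<forall>\<xi>\<in>space M. (1 / real T) * (\<Sum>t<T. ghat i (Xs t \<xi>) (\<omega> t \<xi>)) \<le> c / real V) \<and>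
              (1 / real T) * (\<Sum>t<T. LINT \<xi>|M. ghat i (Xs t \<xi>) (\<omega> t \<xi>)) \<le> c / real V)))))"
proof -
  have run_locale: "online_run M X k D F G \<omega> \<eta> fhat ghat fsub gsub (real V) ((real V)\<^sup>2) x0 Xs Q"
    if "V > 0" "algorithm_run M X k \<omega> \<eta> fhat ghat fsub gsub (real V) ((real V)\<^sup>2) x0 Xs Q"
    for V :: nat and Xs Q
    using that x0 by (intro online_run.intro[OF model] online_run_axioms.intro) simp_all
  have D_nonneg: "D \<ge> 0" and F_nonneg: "F \<ge> 0" and G_nonneg: "G \<ge> 0"
    using online_model.D_nonneg[OF model] online_model.F_nonneg[OF model] online_model.G_pos[OF model]
    by simp_all
  show ?thesis
  proof (intro conjI impI allI ballI, goal_cases)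
    case (1 V Xs Q x T)
    then show ?case
      by (intro online_run.time_average_regret[OF run_locale]) simp_all
  next
    case 2
    show ?case
    proof (intro exI[of _ "C_const k D F G + G\<^sup>2 / 2 + D\<^sup>2"] allI impI ballI, goal_cases)
      case (1 V Xs Q x T)
      then have "real T \<ge> (real V)\<^sup>2"
        by (metis of_nat_le_iff of_nat_power)
      with 1 2 show ?case
        by (intro online_run.time_average_regret_long[OF run_locale]) simp_all
    qed
  next
    case (3 \<epsilon> s V Xs Q T i)
    note run = run_locale[OF 3(2,3)]
    show ?case
      unfolding Let_def
      by (intro conjI ballI online_run.expected_average_le[OF run 3(5)]
          online_run.time_average_constraint[OF run 3(1) refl refl 3(5,4)])
  next
    case (4 \<epsilon> s)
    show ?case
    proof (intro exI[of _ "violation_const k D F G \<epsilon>"] allI impI ballI, goal_cases)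
      case (1 V Xs Q T i)
      note run = run_locale[OF 1(1,2)]
      have T: "(real V)\<^sup>2 \<le> real T"
        using 1(3) by (metis of_nat_le_iff of_nat_power)
      have T_pos: "T > 0"
        using 1(1,3) by (cases T) simp_all
      have "1 \<le> real V" "\<epsilon> > 0"
        using 1(1) 4 by (simp_all add: slater_def)
      note uniform = constraint_bound_le_violation_const[OF this D_nonneg F_nonneg G_nonneg T]
      have "1 / real T * (\<Sum>t<T. ghat i (Xs t \<xi>) (\<omega> t \<xi>)) \<le> violation_const k D F G \<epsilon> / real V"
        if "\<xi> \<in> space M" for \<xi>
        using online_run.time_average_constraint[OF run 4 refl refl 1(4) T_pos that] uniform
        by (rule order_trans)
      then show ?case
        by (intro conjI ballI online_run.expected_average_le[OF run 1(4)])
    qed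
  qed
qed

end
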